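(* Consider the PVRD$^2$ algorithm with pipeline depth $J\ge 1$ and constant step-size $\mu>0$, as defined in the context, under the standing assumptions listed there. There exists $\bar\mu>0$ such that for every step-size $0<\mu\le\bar\mu$ there is a constant $C<\infty$ (independent of $i$) with $$\mathbb{E}\,\|w_{i,k}-w^\star_k\|^2\le \rho^i C\qquad\text{for all agents }k\text{ and all } i>0,$$ where $w^\star=\mathrm{col}\{w_1^\star,\dots,w_K^\star\}$ is the minimizer of $R$, the expectation is over the random sample indices, and $$\rho=\max\Big(1-\frac{1-\lambda^J}{2N},\;1-\frac{\mu\nu}{5}\Big).$$
   Context: Data and risk. There are $N$ data pairs $(h_n,\gamma_n)$, $n=1,\dots,N$, with $h_n\in\mathbb{R}^M$ and scalar labels $\gamma_n$. The feature vector and the parameter are partitioned into $K$ blocks, $h_n=\mathrm{col}\{h_{n,1},\dots,h_{n,K}\}$, $w=\mathrm{col}\{w_1,\dots,w_K\}$ with $h_{n,k},w_k\in\mathbb{R}^{M_k}$, $\sum_k M_k=M$; block $k$ is held by agent $k$. The empirical risk is $$R(w)=\frac1N\sum_{n=1}^N Q\Big(\sum_{k=1}^K h_{n,k}^{\mathsf T}w_k;\gamma_n\Big)+\sum_{k=1}^K r_k(w_k),$$ where $Q(\cdot;\gamma):\mathbb{R}\to\mathbb{R}$ is differentiable with derivative $\nabla_z Q(z;\gamma)$, and $r(w)=\sum_k r_k(w_k)$. Assumptions. (i) For every $n$, the map $w\mapsto Q(h_n^{\mathsf T}w;\gamma_n)$ has $L$-Lipschitz gradient, i.e. $\|\nabla_zQ(h_n^{\mathsf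 T}w_1;\gamma_n)h_n-\nabla_zQ(h_n^{\mathsf T}w_2;\gamma_n)h_n\|\le L\|w_1-w_2\|$, and $|\nabla_zQ(z_1;\gamma_n)-\nabla_zQ(z_2;\gamma_n)|\le\delta|z_1-z_2|$ for all $z_1,z_2$, with $L,\delta>0$. (ii) $r$ is convex with $\eta$-Lipschitz gradient. (iii) $R$ is $\nu$-strongly convex: $(\nabla R(w_1)-\nabla R(w_2))^{\mathsf T}(w_1-w_2)\ge\nu\|w_1-w_2\|^2$; $w^\star$ denotes its unique minimizer. (iv) Agents communicate over a strongly connected graph with combination matrix $A=[a_{\ell k}]\in\mathbb{R}^{K\times K}$, nonnegative, with $a_{\ell k}>0$ only if $\ell=k$ or $\ell$ is a neighbor of $k$ ($\ell\in\mathcal N_k$, where $\mathcal N_k$ includes $k$), $A=A^{\mathsf T}$, $A\mathbf 1_K=\mathbf 1_K$, and $a_{kk}>0$ for at least one $k$. $\lambda\in(0,1)$ denotes the second largest magnitude of the eigenvalues of $A$. PVRD$^2$ algorithm (pipelined variance-reduced dynamic diffusion). Each agent $k$ stores $w_{i,k}$ and scalar tables $u^i_{n,k},v^i_{n,k}$, $n=1,\dots,N$, initialized $w_{1,k}=0$ (equivalently $w_{0,k}=0$), $u^1_{n,k}=v^1_{n,k}=0$. At each iteration $i=1,2,\dots$ an index $n_i$ is drawn uniformly from $\{1,\dots,N\}$, independently of the past, and the same $n_i$ is used by all agents. Agent $k$ forms $z^{(0)}_{n_i,k}=u^i_{n_i,k}+Kh_{n_i,k}^{\mathsf T}w_{i,k}-v^i_{n_i,k}$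 and records $p_{i,k}=Kh_{n_i,k}^{\mathsf T}w_{i,k}$. Pipeline: at iteration $i$, for each $j=0,\dots,J-1$ with $i-j\ge1$, agents compute $z^{(j+1)}_{n_{i-j},k}=\sum_{\ell\in\mathcal N_k}a_{\ell k}z^{(j)}_{n_{i-j},\ell}$ (one communication of a length-$J$ vector per iteration). For $i\ge J$, let $n'_i=n_{i-J+1}$ and update $$w_{i+1,k}=w_{i,k}-\mu\Big\{\big[\nabla_zQ(z^{(J)}_{n'_i,k};\gamma_{n'_i})-\nabla_zQ(u^i_{n'_i,k};\gamma_{n'_i})\big]h_{n'_i,k}+\frac1N\sum_{n=1}^N\nabla_zQ(u^i_{n,k};\gamma_n)h_{n,k}+\nabla r_k(w_{i,k})\Big\},$$ then set $u^{i+1}_{n'_i,k}=z^{(J)}_{n'_i,k}$, $v^{i+1}_{n'_i,k}=p_{i-J+1,k}$, and $u^{i+1}_{n,k}=u^i_{n,k}$, $v^{i+1}_{n,k}=v^i_{n,k}$ for $n\ne n'_i$. (During the warm-up iterations $i<J$ no quantity has yet exited the pipeline; $w$ and the tables are left unchanged.) *)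

theory Defs
  imports "HOL-Analysis.Analysis" "HOL-Computational_Algebra.Polynomial" "HOL-Library.Multiset"
begin

definition charpoly :: "real^'k^'k \<Rightarrow> real poly" where
  "charpoly A = det (\<chi> i j. (if i = j then [:0, 1:] else 0) - [:A$i$j:])"

(* Second largest magnitude among the eigenvalues (counted with multiplicity) of a
   real matrix whose eigenvalues are all real (e.g. a symmetric matrix):
   sort the magnitudes of the roots of the characteristic polynomial increasingly
   and take the second to last one. *)
definition second_largest_eig_mag :: "real^'k^'k \<Rightarrow> real" where
  "second_largest_eig_mag A =
     (let xs = sort (map abs (sorted_list_of_multiset (proots (charpoly A))))
      in xs ! (length xs - 2))"

(* Block structure: blk j = agent holding coordinate j of R^M.
   Local vectors of agent k (elements of R^{M_k}) are represented as vectors of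
   real^'m supported on the coordinates {j. blk j = k}. *)
definition blkdot :: "('m::finite \<Rightarrow> 'k) \<Rightarrow> 'k \<Rightarrow> real^'m \<Rightarrow> real^'m \<Rightarrow> real" where
  "blkdot blk k x y = (\<Sum>j\<in>{j. blk j = k}. x$j * y$j)"

definition blkvec :: "('m::finite \<Rightarrow> 'k) \<Rightarrow> 'k \<Rightarrow> real^'m \<Rightarrow> real^'m" where
  "blkvec blk k x = (\<chi> j. if blk j = k then x$j else 0)"

definition blknorm2 :: "('m::finite \<Rightarrow> 'k) \<Rightarrow> 'k \<Rightarrow> real^'m \<Rightarrow> real^'m \<Rightarrow> real" where
  "blknorm2 blk k x y = (\<Sum>j\<in>{j. blk j = k}. (x$j - y$j)^2)"

(* state at the beginning of iteration i: (w_{i,k}, u^i_{n,k}, v^i_{n,k}) *)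
type_synonym ('m,'k,'n) pvrd_state =
  "('k \<Rightarrow> real^'m) \<times> ('k \<Rightarrow> 'n \<Rightarrow> real) \<times> ('k \<Rightarrow> 'n \<Rightarrow> real)"

definition pvrd_init :: "('m::finite,'k,'n) pvrd_state" where
  "pvrd_init = ((\<lambda>k. 0), (\<lambda>k n. 0), (\<lambda>k n. 0))"

definition combine :: "real^'k^'k \<Rightarrow> ('k::finite \<Rightarrow> real) \<Rightarrow> 'k \<Rightarrow> real" where
  "combine A z k = (\<Sum>l\<in>UNIV. A$l$k * z l)"

definition pvrd_z0 :: "('m::finite \<Rightarrow> 'k::finite) \<Rightarrow> ('n \<Rightarrow> real^'m) \<Rightarrow> 'n
     \<Rightarrow> ('m,'k,'n) pvrd_state \<Rightarrow> 'k \<Rightarrow> real" where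
  "pvrd_z0 blk h n S k =
     (case S of (W, U, V) \<Rightarrow> U k n + real CARD('k) * blkdot blk k (h n) (W k) - V k n)"

definition pvrd_p :: "('m::finite \<Rightarrow> 'k::finite) \<Rightarrow> ('n \<Rightarrow> real^'m) \<Rightarrow> 'n
     \<Rightarrow> ('m,'k,'n) pvrd_state \<Rightarrow> 'k \<Rightarrow> real" where
  "pvrd_p blk h n S k = (case S of (W, U, V) \<Rightarrow> real CARD('k) * blkdot blk k (h n) (W k))"

(* state at iteration i+1 from state S at iteration i and state S' at iteration
   s = i - J + 1 (when the sample n_s = n' exits the pipeline) *)
definition pvrd_next :: "real^'k^'k \<Rightarrow> ('m::finite \<Rightarrow> 'k::finite) \<Rightarrow> ('n::finite \<Rightarrow> real^'m)
     \<Rightarrow> ('n \<Rightarrow> real) \<Rightarrow> (real \<Rightarrow> real \<Rightarrow> real) \<Rightarrow> ('k \<Rightarrow> real^'m \<Rightarrow> real^'m)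
     \<Rightarrow> nat \<Rightarrow> real \<Rightarrow> 'n \<Rightarrow> ('m,'k,'n) pvrd_state \<Rightarrow> ('m,'k,'n) pvrd_state
     \<Rightarrow> ('m,'k,'n) pvrd_state" where
  "pvrd_next A blk h \<gamma> dQ gr J \<mu> n' S S' =
     (case S of (W, U, V) \<Rightarrow>
       (let zJ = (combine A ^^ J) (pvrd_z0 blk h n' S');
            p = pvrd_p blk h n' S'
        in ((\<lambda>k. W k - \<mu> *\<^sub>R
                 ((dQ (zJ k) (\<gamma> n') - dQ (U k n') (\<gamma> n')) *\<^sub>R blkvec blk k (h n')
                  + (1 / real CARD('n)) *\<^sub>R (\<Sum>n\<in>UNIV. dQ (U k n) (\<gamma> n) *\<^sub>R blkvec blk k (h n))
                  + gr k (W k))),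
            (\<lambda>k. (U k)(n' := zJ k)),
            (\<lambda>k. (V k)(n' := p k)))))"

(* pvrd_hist A blk h \<gamma> dQ gr J \<mu> ns m i = state at iteration i, valid for 1 <= i <= m+1;
   ns s is the sample index n_s drawn at iteration s (s >= 1). *)
primrec pvrd_hist :: "real^'k^'k \<Rightarrow> ('m::finite \<Rightarrow> 'k::finite) \<Rightarrow> ('n::finite \<Rightarrow> real^'m)
     \<Rightarrow> ('n \<Rightarrow> real) \<Rightarrow> (real \<Rightarrow> real \<Rightarrow> real) \<Rightarrow> ('k \<Rightarrow> real^'m \<Rightarrow> real^'m)
     \<Rightarrow> nat \<Rightarrow> real \<Rightarrow> (nat \<Rightarrow> 'n) \<Rightarrow> nat \<Rightarrow> nat \<Rightarrow> ('m,'k,'n) pvrd_state" where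
  "pvrd_hist A blk h \<gamma> dQ gr J \<mu> ns 0 = (\<lambda>i. pvrd_init)"
| "pvrd_hist A blk h \<gamma> dQ gr J \<mu> ns (Suc m) =
     (let H = pvrd_hist A blk h \<gamma> dQ gr J \<mu> ns m; i = Suc m in
      H(Suc i := (if i < J then H i
                  else pvrd_next A blk h \<gamma> dQ gr J \<mu> (ns (i - J + 1)) (H i) (H (i - J + 1)))))"

definition pvrd_w :: "real^'k^'k \<Rightarrow> ('m::finite \<Rightarrow> 'k::finite) \<Rightarrow> ('n::finite \<Rightarrow> real^'m)
     \<Rightarrow> ('n \<Rightarrow> real) \<Rightarrow> (real \<Rightarrow> real \<Rightarrow> real) \<Rightarrow> ('k \<Rightarrow> real^'m \<Rightarrow> real^'m)
     \<Rightarrow> nat \<Rightarrow> real \<Rightarrow> (nat \<Rightarrow> 'n) \<Rightarrow> nat \<Rightarrow> 'k \<Rightarrow> real^'m" where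
  "pvrd_w A blk h \<gamma> dQ gr J \<mu> ns i k = fst (pvrd_hist A blk h \<gamma> dQ gr J \<mu> ns i i) k"

(* Expectation over i.i.d. uniform indices n_1, ..., n_i of a quantity depending
   only on these indices: uniform average over all sample paths. *)
definition expect_paths :: "nat \<Rightarrow> ((nat \<Rightarrow> 'n::finite) \<Rightarrow> real) \<Rightarrow> real" where
  "expect_paths i f = (\<Sum>ns\<in>PiE {1..i} (\<lambda>_. UNIV). f ns) / real CARD('n) ^ i"

end

theory Submission
  imports Defs
begin

text \<open>
  It suffices to prove the bound with the smaller rate \<open>1 - \<mu> \<nu> / 5\<close> in place of \<open>\<rho>\<close>. Of the combination matrix only one fact is needed: its powers contract the
  zero-sum vectors by some factor \<open>\<theta> < 1\<close>, since the maximal stretch of a zero-sum vector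
  is the magnitude of an eigenvalue whose eigenvector is independent of the constant vector.

  Three squared errors are tracked: \<open>ea\<close>, the distance of \<open>w\<close> to the minimizer; \<open>eb\<close>, the deviation
  of the \<open>u\<close> tables from network consensus; and \<open>ed\<close>, the staleness \<open>p - v\<close> of the \<open>v\<close> tables. The sums
  over agents of the \<open>u\<close> and \<open>v\<close> tables always agree, so the network mean of a \<open>z\<close> leaving the
  pipeline is an exact, merely delayed, prediction. The leaving sample is independent of the
  current state, hence the mean update is the gradient of the risk up to errors of size
  \<open>eb + ed\<close>. In expectation \<open>ea\<close> contracts at rate \<open>1 - \<mu> \<nu>\<close> with input \<open>\<mu> (eb + ed)\<close>, \<open>eb\<close> contracts
  at a fixed rate with input \<open>ed\<close>, and \<open>ed\<close> contracts at a fixed rate with input \<open>\<mu>\<^sup>2\<close> times the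
  recent errors, because \<open>w\<close> moves by \<open>O(\<mu>)\<close> per iteration. The total gain around this loop vanishes
  with \<open>\<mu>\<close>.
\<close>

section \<open>Contraction of the combination matrix\<close>

lemma det_const_poly:
  fixes P :: "real^'k^'k"
  shows "det (\<chi> i j. [:P$i$j:]) = [:det P:]"
proof -
  have prod: "(\<Prod>i\<in>S. [:f i:]) = [:\<Prod>i\<in>S. f i:]" if "finite S" for S and f :: "'k \<Rightarrow> real"
    using that by induction (auto simp: one_pCons)
  show ?thesis
    by (simp add: det_def prod of_int_poly mult.commute flip: sum_to_poly)
qed

lemma poly_charpoly: "poly (charpoly A) t = det (\<chi> i j. (if i = j then t else 0) - A$i$j)"
proof -
  have "poly (\<Prod>i\<in>UNIV. (if i = p i then [:0, 1:] else 0) - [:A$i$p i:]) t =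
        (\<Prod>i\<in>UNIV. (if i = p i then t else 0) - A$i$p i)" for p
    by (auto simp: poly_prod intro!: prod.cong)
  then show ?thesis
    by (simp add: charpoly_def det_def poly_sum)
qed

text \<open>For \<open>t\<close> above the operator norm, t I - A has trivial kernel, so the
  polynomial does not vanish at \<open>t\<close>. Nonvanishing is what allows \<open>proots\<close>
  to be split along a factorization later.\<close>

lemma charpoly_nonzero: "charpoly A \<noteq> 0"
proof
  assume *: "charpoly A = 0"
  define t where "t = onorm ((*v) A) + 1"
  let ?M = "\<chi> i j. (if i = j then t else 0) - A$i$j"
  have bl: "bounded_linear ((*v) A)"
    by (simp add: linear_linear)
  have "x = 0" if "?M *v x = 0" for x
  proof -
    have "(\<Sum>j\<in>UNIV. (if i = j then t else 0) * x$j) = (\<Sum>j\<in>UNIV. if i = j then t * x$j else 0)" for i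
      by (rule sum.cong) auto
    then have "?M *v x = t *\<^sub>R x - A *v x"
      by (simp add: vec_eq_iff matrix_vector_mult_def left_diff_distrib sum_subtractf)
    with that have eq: "A *v x = t *\<^sub>R x"
      by simp
    have "\<bar>t\<bar> * norm x \<le> onorm ((*v) A) * norm x"
      using onorm[OF bl, of x] by (simp add: eq)
    moreover have "\<bar>t\<bar> = onorm ((*v) A) + 1"
      using onorm_pos_le[OF bl] by (simp add: t_def)
    ultimately show ?thesis
      by (simp add: distrib_right)
  qed
  then have "det ?M \<noteq> 0"
    unfolding invertible_det_nz[symmetric] invertible_left_inverse matrix_left_invertible_ker by blast
  then show False
    using poly_charpoly[of A t] * by simp
qed

text \<open>Putting \<open>u\<close> and \<open>v\<close> in place of columns \<open>k\<close> and
  \<open>l\<close> of the identity gives a matrix \<open>P\<close>, invertible because of the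
  nonzero minor. Columns \<open>k\<close> and \<open>l\<close> of (x I - A) P are (x - a) u and (x -
  b) v, so both linear factors come out of the determinant, even when \<open>a = b\<close>.\<close>

lemma eigenvector_pair_charpoly_dvd:
  fixes A :: "real^'k^'k"
  assumes u: "A *v u = a *\<^sub>R u" and v: "A *v v = b *\<^sub>R v"
    and indep: "u$k * v$l \<noteq> u$l * v$k"
  shows "[:-a, 1:] * [:-b, 1:] dvd charpoly A"
proof -
  have kl: "k \<noteq> l"
    using indep by auto
  define P :: "real^'k^'k" where
    "P = (\<chi> i j. if j = k then u$i else if j = l then v$i else if i = j then 1 else 0)"
  define M :: "real poly^'k^'k" where
    "M = (\<chi> i j. (if i = j then [:0, 1:] else 0) - [:A$i$j:])"
  define PP where "PP = (\<chi> i j. [:P$i$j:])"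
  have "c = 0" if "P *v c = 0" for c
  proof -
    have row: "(\<Sum>j\<in>UNIV. P$i$j * c$j) = 0" for i
      using that by (simp add: vec_eq_iff matrix_vector_mult_def)
    have split: "(\<Sum>j\<in>UNIV. P$i$j * c$j) = u$i * c$k + v$i * c$l + (\<Sum>j\<in>UNIV-{k}-{l}. P$i$j * c$j)" for i
    proof -
      have "(\<Sum>j\<in>UNIV. P$i$j * c$j) = P$i$k * c$k + (P$i$l * c$l + (\<Sum>j\<in>UNIV-{k}-{l}. P$i$j * c$j))"
        using kl by (simp add: sum.remove[of UNIV k] sum.remove[of "UNIV - {k}" l])
      then show ?thesis
        using kl by (simp add: P_def)
    qed
    have rest: "(\<Sum>j\<in>UNIV-{k}-{l}. P$i$j * c$j) = (if i = k \<or> i = l then 0 else c$i)" for i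
    proof -
      have "(\<Sum>j\<in>UNIV-{k}-{l}. P$i$j * c$j) = (\<Sum>j\<in>UNIV-{k}-{l}. if j = i then c$j else 0)"
        by (rule sum.cong) (auto simp: P_def)
      then show ?thesis
        by (simp add: sum.delta)
    qed
    have k: "u$k * c$k + v$k * c$l = 0" and l: "u$l * c$k + v$l * c$l = 0"
      using row[of k] row[of l] by (simp_all add: split rest)
    \<comment> \<open>Cramer's rule for the two rows \<open>k\<close> and \<open>l\<close>.\<close>
    have "(u$k * v$l - u$l * v$k) * c$k = v$l * (u$k * c$k + v$k * c$l) - v$k * (u$l * c$k + v$l * c$l)"
      "(u$k * v$l - u$l * v$k) * c$l = u$k * (u$l * c$k + v$l * c$l) - u$l * (u$k * c$k + v$k * c$l)"
      by (simp_all add: algebra_simps)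
    then have "(u$k * v$l - u$l * v$k) * c$k = 0" "(u$k * v$l - u$l * v$k) * c$l = 0"
      unfolding k l by simp_all
    then have ck: "c$k = 0" and cl: "c$l = 0"
      using indep by simp_all
    have "c$i = 0" for i
      using row[of i] ck cl by (auto simp: split rest split: if_splits)
    then show "c = 0"
      by (simp add: vec_eq_iff)
  qed
  then have detP: "det P \<noteq> 0"
    unfolding invertible_det_nz[symmetric] invertible_left_inverse matrix_left_invertible_ker by blast
  have Mx: "(\<Sum>j\<in>UNIV. M$i$j * [:x$j:]) = [:-e, 1:] * [:x$i:]" if "A *v x = e *\<^sub>R x" for x e i
  proof -
    have "(\<Sum>j\<in>UNIV. M$i$j * [:x$j:]) = (\<Sum>j\<in>UNIV. (if i = j then [:0, x$j:] else 0) - [:A$i$j * x$j:])"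
      by (rule sum.cong) (auto simp: M_def)
    also have "\<dots> = [:0, x$i:] - [:(A *v x)$i:]"
      by (simp add: sum_subtractf sum_to_poly matrix_vector_mult_def)
    finally show ?thesis
      by (simp add: that)
  qed
  \<comment> \<open>Transposing turns the two eigenvector columns into rows, from which
    \<open>det_row_mul\<close> extracts the factors.\<close>
  define T where "T = transpose (M ** PP)"
  have T: "T = (\<chi> i. if i = k then [:-a, 1:] *s (\<chi> j. [:u$j:]) else
                 if i = l then [:-b, 1:] *s (\<chi> j. [:v$j:]) else T$i)"
  proof -
    have "T$k$j = [:-a, 1:] * [:u$j:]" for j
      using Mx[OF u, of j] by (simp add: T_def transpose_def matrix_matrix_mult_def PP_def P_def)
    moreover have "T$l$j = [:-b, 1:] * [:v$j:]" for j
      using Mx[OF v, of j] kl by (simp add: T_def transpose_def matrix_matrix_mult_def PP_def P_def)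
    ultimately show ?thesis
      by (simp add: vec_eq_iff)
  qed
  define T1 where "T1 = (\<chi> i. if i = k then (\<chi> j. [:u$j:]) else
                 if i = l then [:-b, 1:] *s (\<chi> j. [:v$j:]) else T$i)"
  define T2 where "T2 = (\<chi> i. if i = l then (\<chi> j. [:v$j:]) else
                 if i = k then (\<chi> j. [:u$j:]) else T$i)"
  have "det T = [:-a, 1:] * det T1"
    unfolding T1_def by (subst T, subst det_row_mul) simp
  moreover have T1: "T1 = (\<chi> i. if i = l then [:-b, 1:] *s (\<chi> j. [:v$j:]) else
                 if i = k then (\<chi> j. [:u$j:]) else T$i)"
    using kl by (auto simp: T1_def vec_eq_iff)
  have "det T1 = [:-b, 1:] * det T2"
    unfolding T2_def by (subst T1, subst det_row_mul) simp
  moreover have "det T = charpoly A * [:det P:]"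
    by (simp add: T_def det_transpose det_mul PP_def det_const_poly charpoly_def M_def)
  ultimately have "charpoly A * [:det P:] = [:-a, 1:] * [:-b, 1:] * det T2"
    by (simp only: mult.assoc)
  moreover have "charpoly A * [:det P:] = smult (det P) (charpoly A)"
    by simp
  ultimately have "[:-a, 1:] * [:-b, 1:] dvd smult (det P) (charpoly A)"
    by (metis dvd_triv_left)
  then show ?thesis
    using dvd_smult_cancel detP by blast
qed

text \<open>Counting: otherwise every entry but the last lies below \<open>c\<close>, while the
  occurrences of \<open>x\<close> and \<open>y\<close> are two entries that do not.\<close>

lemma second_to_last_ge:
  fixes xs :: "real list"
  assumes "sorted xs" and "{#x, y#} \<subseteq># mset xs" and "c \<le> x" "c \<le> y"
  shows "c \<le> xs ! (length xs - 2)"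
proof (rule ccontr)
  assume neg: "\<not> c \<le> xs ! (length xs - 2)"
  let ?n = "length xs - 1"
  have "size {#x, y#} \<le> size (mset xs)"
    using assms(2) by (rule size_mset_mono)
  then have len: "length xs \<ge> 2"
    by simp
  have "z < c" if "z \<in> set (take ?n xs)" for z
  proof -
    obtain i where i: "i < ?n" "z = xs ! i"
      using \<open>z \<in> _\<close> by (auto simp: in_set_conv_nth)
    then have "z \<le> xs ! (length xs - 2)"
      using len by (auto intro!: sorted_nth_mono[OF assms(1)])
    with neg show ?thesis
      by simp
  qed
  then have "filter (\<lambda>z. c \<le> z) (take ?n xs) = []"
    by (force simp: filter_empty_conv)
  moreover have "xs = take ?n xs @ [last xs]"
    using len by (metis append_butlast_last_id butlast_conv_take length_greater_0_conv not_numeral_le_zero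
        bot_nat_0.not_eq_extremum)
  ultimately have "length (filter (\<lambda>z. c \<le> z) xs) \<le> 1"
    by (metis (no_types, lifting) append_Nil filter.simps filter_append le_numeral_extra(4) length_Cons
        list.size(3) One_nat_def zero_le_one)
  moreover have "filter_mset (\<lambda>z. c \<le> z) {#x, y#} \<subseteq># filter_mset (\<lambda>z. c \<le> z) (mset xs)"
    using assms(2) by (rule multiset_filter_mono)
  then have "size (filter_mset (\<lambda>z. c \<le> z) {#x, y#}) \<le> length (filter (\<lambda>z. c \<le> z) xs)"
    by (metis mset_filter size_mset size_mset_mono)
  ultimately show False
    using assms(3,4) by simp
qed

text \<open>An independent pair of eigenvectors contributes two roots counted with multiplicity, so
  at least two of the sorted magnitudes reach \<open>c\<close>.\<close>

lemma second_largest_eig_mag_ge: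
  fixes A :: "real^'k^'k"
  assumes "A *v u = a *\<^sub>R u" and "A *v v = b *\<^sub>R v"
    and "u$k * v$l \<noteq> u$l * v$k" and "c \<le> \<bar>a\<bar>" "c \<le> \<bar>b\<bar>"
  shows "c \<le> second_largest_eig_mag A"
proof -
  let ?xs = "sort (map abs (sorted_list_of_multiset (proots (charpoly A))))"
  obtain q where q: "charpoly A = [:-a, 1:] * [:-b, 1:] * q"
    using eigenvector_pair_charpoly_dvd[OF assms(1-3)] by (rule dvdE)
  then have nz: "q \<noteq> 0" "[:-a, 1:] * [:-b, 1:] \<noteq> 0"
    using charpoly_nonzero[of A] by auto
  have "proots (charpoly A) = proots ([:-a, 1:] * [:-b, 1:]) + proots q"
    unfolding q by (rule proots_mult[OF nz(2,1)])
  also have "proots ([:-a, 1:] * [:-b, 1:]) = {#a, b#}"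
    by (subst proots_mult) auto
  finally have "{#\<bar>a\<bar>, \<bar>b\<bar>#} \<subseteq># mset ?xs"
    by simp
  then have "c \<le> ?xs ! (length ?xs - 2)"
    by (rule second_to_last_ge[OF sorted_sort _ assms(4,5)])
  then show ?thesis
    by (simp add: second_largest_eig_mag_def Let_def)
qed

text \<open>By symmetry the squared norm of (A^2 - \<theta>^2) x0 expands to at most 0, hence (A -
  \<theta>)(A + \<theta>) x0 = 0. Either x0 is an eigenvector for -\<theta>, or (A + \<theta>) x0 is
  one for \<theta>.\<close>

lemma symmetric_norm_maximizer_eigenvector:
  fixes A :: "real^'k^'k"
  assumes sym: "transpose A = A" and sub: "subspace S" and inv: "\<And>x. x \<in> S \<Longrightarrow> A *v x \<in> S"
    and x0: "x0 \<in> S" "norm x0 = 1" "norm (A *v x0) = \<theta>"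
    and bound: "\<And>x. x \<in> S \<Longrightarrow> norm (A *v x) \<le> \<theta> * norm x"
  obtains y b where "y \<in> S" "y \<noteq> 0" "A *v y = b *\<^sub>R y" "\<bar>b\<bar> = \<theta>"
proof -
  have \<theta>: "\<theta> \<ge> 0"
    using x0(3) by auto
  have adj: "(A *v x) \<bullet> y = x \<bullet> (A *v y)" for x y
    by (metis dot_lmul_matrix sym transpose_matrix_vector)
  let ?x1 = "A *v x0" and ?x2 = "A *v (A *v x0)"
  have sq: "(norm (?x2 - \<theta>\<^sup>2 *\<^sub>R x0))\<^sup>2 = (norm ?x2)\<^sup>2 - 2 * \<theta>\<^sup>2 * (norm ?x1)\<^sup>2 + \<theta>^4 * (norm x0)\<^sup>2"
    using adj[of ?x1 x0] unfolding power2_norm_eq_inner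
    by (simp add: inner_diff inner_commute power2_eq_square power4_eq_xxxx algebra_simps)
  have "norm ?x2 \<le> \<theta> * \<theta>"
    using bound[OF inv[OF x0(1)]] x0(3) by simp
  then have "(norm ?x2)\<^sup>2 \<le> (\<theta> * \<theta>)\<^sup>2"
    by (rule power_mono) simp
  then have "(norm (?x2 - \<theta>\<^sup>2 *\<^sub>R x0))\<^sup>2 \<le> 0"
    unfolding sq x0 by (simp add: power2_eq_square power4_eq_xxxx algebra_simps)
  then have x2: "?x2 = \<theta>\<^sup>2 *\<^sub>R x0"
    by simp
  show thesis
  proof (cases "?x1 + \<theta> *\<^sub>R x0 = 0")
    case True
    then have "?x1 = (-\<theta>) *\<^sub>R x0"
      by (simp add: eq_neg_iff_add_eq_0)
    then show ?thesis
      using x0 \<theta> by (intro that[of x0 "-\<theta>"]) auto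
  next
    case False
    have "A *v (?x1 + \<theta> *\<^sub>R x0) = \<theta> *\<^sub>R (?x1 + \<theta> *\<^sub>R x0)"
      by (simp add: matrix_vector_right_distrib matrix_vector_mult_scaleR x2 power2_eq_square
          scaleR_right_distrib)
    moreover have "?x1 + \<theta> *\<^sub>R x0 \<in> S"
      using inv x0(1) sub by (simp add: subspace_add subspace_scale)
    ultimately show ?thesis
      using False \<theta> by (intro that[of "?x1 + \<theta> *\<^sub>R x0" \<theta>]) auto
  qed
qed

text \<open>By compactness the largest stretch of zero-sum unit vectors is attained, and it equals
  |b| for some zero-sum eigenvector. That vector is not constant, hence independent of the constant
  one, whose eigenvalue is 1; |b| \<ge> 1 would force the second largest magnitude up to at least
  1.\<close>

lemma symmetric_stochastic_contraction:
  fixes A :: "real^'k^'k"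
  assumes sym: "transpose A = A" and stoch: "A *v (\<chi> k. 1) = (\<chi> k. 1)"
    and lam: "second_largest_eig_mag A < 1"
  obtains \<theta> where "0 < \<theta>" "\<theta> < 1"
    "\<And>x. (\<Sum>k\<in>UNIV. x$k) = 0 \<Longrightarrow> norm (A *v x) \<le> \<theta> * norm x"
proof -
  define one :: "real^'k" where "one = (\<chi> k. 1)"
  define S where "S = {x. one \<bullet> x = 0}"
  have one: "one \<bullet> x = (\<Sum>k\<in>UNIV. x$k)" for x
    by (simp add: one_def inner_vec_def)
  have sub: "subspace S"
    unfolding S_def by (rule subspace_hyperplane)
  have inv: "A *v x \<in> S" if "x \<in> S" for x
  proof -
    have "one \<bullet> (A *v x) = (A *v one) \<bullet> x"
      by (metis dot_lmul_matrix sym transpose_matrix_vector)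
    then show ?thesis
      using that stoch by (simp add: S_def one_def)
  qed
  have "\<exists>\<theta><1. \<forall>x\<in>S. norm (A *v x) \<le> \<theta> * norm x"
  proof (cases "S \<subseteq> {0}")
    \<comment> \<open>With a single agent there is no zero-sum unit vector to maximize over.\<close>
    case True
    then show ?thesis
      by (intro exI[of _ 0]) auto
  next
    case False
    then obtain x1 where x1: "x1 \<in> S" "x1 \<noteq> 0"
      by auto
    then have "(1 / norm x1) *\<^sub>R x1 \<in> S \<inter> sphere 0 1"
      using sub by (simp add: subspace_scale)
    then have ne: "S \<inter> sphere 0 1 \<noteq> {}"
      by blast
    have "compact (S \<inter> sphere 0 1)"
      unfolding S_def by (intro closed_Int_compact closed_hyperplane) auto
    moreover have "continuous_on (S \<inter> sphere 0 1) (\<lambda>x. norm (A *v x))"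
      by (intro continuous_intros linear_continuous_on) (simp add: linear_linear)
    ultimately obtain x0 where x0': "x0 \<in> S \<inter> sphere 0 1"
      and max': "\<forall>x\<in>S \<inter> sphere 0 1. norm (A *v x) \<le> norm (A *v x0)"
      using continuous_attains_sup[of "S \<inter> sphere 0 1" "\<lambda>x. norm (A *v x)"] ne by blast
    have x0: "x0 \<in> S" "norm x0 = 1"
      using x0' by simp_all
    have max: "norm (A *v x) \<le> norm (A *v x0)" if "x \<in> S" "norm x = 1" for x
      using max' that by simp
    have bound: "norm (A *v x) \<le> norm (A *v x0) * norm x" if "x \<in> S" for x
    proof (cases "x = 0")
      case False
      have "norm (A *v ((1 / norm x) *\<^sub>R x)) \<le> norm (A *v x0)"
        using that sub False by (intro max) (auto simp: subspace_scale)
      then show ?thesis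
        using False by (simp add: matrix_vector_mult_scaleR divide_simps)
    qed simp
    obtain y b where y: "y \<in> S" "y \<noteq> 0" "A *v y = b *\<^sub>R y" "\<bar>b\<bar> = norm (A *v x0)"
      using symmetric_norm_maximizer_eigenvector[OF sym sub inv x0(1,2) refl bound] by blast
    have "\<exists>k l. y$k \<noteq> y$l"
    proof (rule ccontr)
      assume "\<not> ?thesis"
      then obtain c where c: "\<And>k. y$k = c"
        by metis
      have "(\<Sum>k\<in>UNIV. y$k) = 0"
        using y(1) by (simp add: S_def one)
      then have "c = 0"
        by (simp add: c)
      with c y(2) show False
        by (simp add: vec_eq_iff)
    qed
    then obtain k l where kl: "y$l \<noteq> y$k"
      by metis
    have "\<not> 1 \<le> \<bar>b\<bar>"
      using second_largest_eig_mag_ge[of A one 1 y b k l 1] stoch y(3) kl lam by (auto simp: one_def)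
    then show ?thesis
      using y(4) bound by (intro exI[of _ "norm (A *v x0)"]) auto
  qed
  then obtain \<theta> where \<theta>: "\<theta> < 1" "\<And>x. x \<in> S \<Longrightarrow> norm (A *v x) \<le> \<theta> * norm x"
    by blast
  show thesis
  proof
    \<comment> \<open>The largest stretch may be 0; the maximum with 1/2 gives a positive factor, by
      which later estimates can divide.\<close>
    show "0 < max \<theta> (1/2)" "max \<theta> (1/2) < 1"
      using \<theta>(1) by auto
    fix x :: "real^'k" assume "(\<Sum>k\<in>UNIV. x$k) = 0"
    then have "norm (A *v x) \<le> \<theta> * norm x"
      by (intro \<theta>(2)) (simp add: S_def one)
    also have "\<dots> \<le> max \<theta> (1/2) * norm x"
      by (intro mult_right_mono) auto
    finally show "norm (A *v x) \<le> max \<theta> (1/2) * norm x" .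
  qed
qed

section \<open>Expectation over sample paths\<close>

lemma expect_paths_add: "expect_paths i (\<lambda>ns. f ns + g ns) = expect_paths i f + expect_paths i g"
  by (simp add: expect_paths_def sum.distrib add_divide_distrib)

lemma expect_paths_cmult: "expect_paths i (\<lambda>ns. c * f ns) = c * expect_paths i f"
  by (simp add: expect_paths_def sum_distrib_left)

lemma expect_paths_sum:
  "expect_paths i (\<lambda>ns. \<Sum>x\<in>X. f x ns) = (\<Sum>x\<in>X. expect_paths i (f x))"
  unfolding expect_paths_def by (subst sum.swap) (simp add: sum_divide_distrib)

lemma expect_paths_mono: "(\<And>ns. f ns \<le> g ns) \<Longrightarrow> expect_paths i f \<le> expect_paths i g"
  by (simp add: expect_paths_def sum_mono divide_right_mono)

lemma expect_paths_nonneg: "(\<And>ns. 0 \<le> f ns) \<Longrightarrow> 0 \<le> expect_paths i f"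
  by (simp add: expect_paths_def sum_nonneg)

text \<open>Conditioning on all but the last index. Every one-step average below arises in this
  way.\<close>

lemma expect_paths_Suc:
  fixes f :: "(nat \<Rightarrow> 'n::finite) \<Rightarrow> real"
  shows "expect_paths (Suc i) f =
    expect_paths i (\<lambda>ns. (\<Sum>n\<in>UNIV. f (ns(Suc i := n))) / real CARD('n))"
proof -
  let ?P = "PiE {1..i} (\<lambda>_. UNIV :: 'n set)"
  have "PiE {1..Suc i} (\<lambda>_. UNIV :: 'n set) = (\<lambda>(y, g). g(Suc i := y)) ` (UNIV \<times> ?P)"
    by (simp add: PiE_insert_eq atLeastAtMostSuc_conv)
  then have "(\<Sum>ns\<in>PiE {1..Suc i} (\<lambda>_. UNIV). f ns) = (\<Sum>(n, ns)\<in>UNIV \<times> ?P. f (ns(Suc i := n)))"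
    by (subst sum.reindex_cong[OF inj_combinator]) (auto simp: case_prod_unfold)
  also have "\<dots> = (\<Sum>ns\<in>?P. \<Sum>n\<in>UNIV. f (ns(Suc i := n)))"
    by (subst sum.cartesian_product[symmetric], subst sum.swap) simp
  finally show ?thesis
    by (simp add: expect_paths_def sum_divide_distrib)
qed

text \<open>Trailing indices are peeled off one at a time: one that \<open>f\<close> does not read
  is an average over a constant.\<close>

lemma expect_paths_cong_dependence:
  fixes f :: "(nat \<Rightarrow> 'n::finite) \<Rightarrow> real"
  assumes dep: "\<And>ns ns'. (\<And>s. 1 \<le> s \<Longrightarrow> s \<le> m \<Longrightarrow> ns s = ns' s) \<Longrightarrow> f ns = f ns'"
    and "m \<le> i"
  shows "expect_paths i f = expect_paths m f"
  using assms(2)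
proof (induction i rule: dec_induct)
  case (step i)
  have "f (ns(Suc i := n)) = f ns" for ns n
    using step by (intro dep) auto
  then have "expect_paths (Suc i) f = expect_paths i f"
    by (simp add: expect_paths_Suc)
  with step show ?case
    by simp
qed simp

section \<open>Linear convergence of the delayed recursion\<close>

text \<open>Here \<open>a\<close>, \<open>b\<close>, \<open>d\<close> stand for the expected
  \<open>ea\<close>, \<open>eb\<close>, \<open>ed\<close>. The sample leaving the pipeline at
  \<open>i\<close> was drawn at \<open>s\<close>, and \<Delta> collects the errors that drive the
  motion of \<open>w\<close> in between. Starting at \<open>2 * J\<close> keeps the subtraction in
  \<open>j - J + 1\<close> from being truncated.\<close>

definition delayed_recursion ::
    "nat \<Rightarrow> real \<Rightarrow> real \<Rightarrow> real \<Rightarrow> real \<Rightarrow> real \<Rightarrow> (nat \<Rightarrow> real) \<Rightarrow> (nat \<Rightarrow> real) \<Rightarrow> (nat \<Rightarrow> real) \<Rightarrow> bool" where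
  "delayed_recursion J N c \<theta> \<nu> \<mu> a b d \<longleftrightarrow> (\<forall>i\<ge>2 * J.
     let s = i - J + 1;
         \<Delta> = (\<Sum>j\<in>{s..i}. (a j + b j + d j) + (a (j - J + 1) + b (j - J + 1) + d (j - J + 1)))
     in a (Suc i) \<le> (1 - \<mu> * \<nu>) * a i + \<mu> * c * (b s + d s) + \<mu>\<^sup>2 * c * \<Delta> \<and>
        b (Suc i) \<le> (1 - 1 / N) * b i + \<theta> / N * b s + c * d s \<and>
        d (Suc i) \<le> (1 - 1 / (2 * N)) * d i + \<mu>\<^sup>2 * c * \<Delta>)"

text \<open>The induction hypothesis is the ansatz \<open>a i \<le> C \<rho>^i\<close>, \<open>b i \<le> \<beta> C \<rho>^i\<close>,
  \<open>d i \<le> \<kappa> C \<rho>^i\<close> with \<open>\<rho> = 1 - \<mu> \<nu> / 5\<close>. A delay of at most \<open>2 J\<close> costs a factor of at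
  most \<open>q\<close>, which is close enough to 1 to keep \<open>\<theta> q < 1\<close>. The ratio \<open>\<beta>\<close> is fixed by the
  gain from \<open>b\<close> to \<open>a\<close>, then \<open>\<kappa>\<close> by the gain from \<open>d\<close> to \<open>b\<close>; the gain from \<open>a\<close> to \<open>d\<close>
  carries a factor \<open>\<mu>\<^sup>2\<close>, so the loop closes for small \<open>\<mu>\<close>.\<close>

lemma delayed_recursion_induct:
  fixes a b d :: "nat \<Rightarrow> real"
  assumes J: "J \<ge> 1" and N: "N \<ge> 1" and c: "c \<ge> 1" and \<theta>: "0 < \<theta>" "\<theta> < 1"
    and \<mu>: "0 < \<mu>" "\<mu> \<le> 1" and \<nu>: "0 < \<nu>"
    and \<beta>: "0 < \<beta>" "\<beta> \<le> 1" "10 * c * \<beta> \<le> \<nu>"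
    and \<kappa>: "0 < \<kappa>" "\<kappa> \<le> \<beta>" "8 * c * N * \<kappa> \<le> \<beta> * (1 - \<theta>)"
    and q: "1 \<le> q" "q \<le> 2" "2 * (\<theta> * q) \<le> 1 + \<theta>" "1 \<le> q * (1 - \<mu> * \<nu> / 5) ^ (2 * J)"
    and small: "\<mu> * \<nu> \<le> (1 - \<theta>) / (4 * N)" "\<mu> * (30 * c * J) \<le> \<nu>"
      "\<mu> * (48 * c * J * N) \<le> \<kappa>"
    and C: "C \<ge> 0"
    and rec: "delayed_recursion J N c \<theta> \<nu> \<mu> a b d"
    and init: "\<And>i. i \<le> 2 * J \<Longrightarrow> a i \<le> C * (1 - \<mu> * \<nu> / 5) ^ i \<and>
          b i \<le> \<beta> * C * (1 - \<mu> * \<nu> / 5) ^ i \<and> d i \<le> \<kappa> * C * (1 - \<mu> * \<nu> / 5) ^ i"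
  shows "a i \<le> C * (1 - \<mu> * \<nu> / 5) ^ i \<and>
    b i \<le> \<beta> * C * (1 - \<mu> * \<nu> / 5) ^ i \<and> d i \<le> \<kappa> * C * (1 - \<mu> * \<nu> / 5) ^ i"
proof (induction i rule: less_induct)
  case (less i)
  define \<Delta> where "\<Delta> i = (\<Sum>j\<in>{i - J + 1..i}. (a j + b j + d j) +
      (a (j - J + 1) + b (j - J + 1) + d (j - J + 1)))" for i
  have a: "a (Suc i) \<le> (1 - \<mu> * \<nu>) * a i + \<mu> * c * (b (i - J + 1) + d (i - J + 1)) + \<mu>\<^sup>2 * c * \<Delta> i"
    and b: "b (Suc i) \<le> (1 - 1 / N) * b i + \<theta> / N * b (i - J + 1) + c * d (i - J + 1)"
    and d: "d (Suc i) \<le> (1 - 1 / (2 * N)) * d i + \<mu>\<^sup>2 * c * \<Delta> i"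
    if "2 * J \<le> i" for i
    using rec that unfolding delayed_recursion_def Let_def \<Delta>_def by blast+
  define \<rho> where "\<rho> = 1 - \<mu> * \<nu> / 5"
  have "(1 - \<theta>) / (4 * N) \<le> 1 / 4"
    using N \<theta> by (simp add: divide_simps)
  with small(1) have "\<mu> * \<nu> \<le> 1/4"
    by (rule order_trans)
  moreover have "0 < \<mu> * \<nu>"
    using \<mu> \<nu> by simp
  ultimately have \<mu>\<nu>: "\<mu> * \<nu> \<le> 1/4" "0 < \<mu> * \<nu>"
    by simp_all
  then have \<rho>: "0 < \<rho>" "\<rho> \<le> 1"
    by (simp_all add: \<rho>_def)
  show ?case
  proof (cases "i \<le> 2 * J")
    case True
    then show ?thesis
      by (rule init)
  next
    case False
    then obtain m where m: "i = Suc m" "m \<ge> 2 * J"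
      by (cases i) auto
    define X where "X = C * \<rho> ^ m"
    have X: "X \<ge> 0"
      using C \<rho> by (simp add: X_def)
    have delay: "C * \<rho> ^ j \<le> q * X" if "m \<le> j + 2 * J" for j
    proof -
      have "\<rho> ^ j * 1 \<le> \<rho> ^ j * (q * \<rho> ^ (2 * J))"
        using q(4) \<rho> by (intro mult_left_mono) (auto simp: \<rho>_def)
      also have "\<dots> = q * \<rho> ^ (j + 2 * J)"
        by (simp add: power_add)
      also have "\<dots> \<le> q * \<rho> ^ m"
        using that q \<rho> by (intro mult_left_mono power_decreasing) auto
      finally show ?thesis
        using C by (metis X_def mult.left_commute mult.right_neutral mult_left_mono)
    qed
    have IHa: "a j \<le> q * X" and IHb: "b j \<le> \<beta> * (q * X)" and IHd: "d j \<le> \<kappa> * (q * X)"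
      if "j \<le> m" "m \<le> j + 2 * J" for j
    proof -
      have IH: "a j \<le> C * \<rho> ^ j" "b j \<le> \<beta> * (C * \<rho> ^ j)" "d j \<le> \<kappa> * (C * \<rho> ^ j)"
        using less[of j] that m by (auto simp: \<rho>_def mult.assoc)
      show "a j \<le> q * X"
        using IH(1) delay[OF that(2)] by simp
      show "b j \<le> \<beta> * (q * X)"
        using IH(2) mult_left_mono[OF delay[OF that(2)], of \<beta>] \<beta> by linarith
      show "d j \<le> \<kappa> * (q * X)"
        using IH(3) mult_left_mono[OF delay[OF that(2)], of \<kappa>] \<kappa> by linarith
    qed
    have IHm: "a m \<le> X" "b m \<le> \<beta> * X" "d m \<le> \<kappa> * X"
      using less[of m] m by (auto simp: \<rho>_def X_def mult.assoc)
    have qX: "q * X \<le> 2 * X"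
      using q X by (intro mult_right_mono) auto
    \<comment> \<open>Since \<beta> and \<kappa> are at most 1 and q is at most 2, each of the three
      errors is at most 2 X.\<close>
    have Y: "a j + b j + d j \<le> 6 * X" if "j \<le> m" "m \<le> j + 2 * J" for j
    proof -
      have "\<beta> * (q * X) \<le> 1 * (q * X)" "\<kappa> * (q * X) \<le> 1 * (q * X)"
        using \<beta> \<kappa> q X by (intro mult_right_mono; simp)+
      then show ?thesis
        using IHa[OF that] IHb[OF that] IHd[OF that] qX by linarith
    qed
    have "\<Delta> m \<le> of_nat (card {m - J + 1..m}) * (6 * X + 6 * X)"
      unfolding \<Delta>_def
    proof (rule sum_bounded_above)
      fix j assume "j \<in> {m - J + 1..m}"
      then show "a j + b j + d j + (a (j - J + 1) + b (j - J + 1) + d (j - J + 1)) \<le> 6 * X + 6 * X"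
        using m J by (intro add_mono Y) auto
    qed
    moreover have "card {m - J + 1..m} = J"
      using m J by auto
    ultimately have \<Delta>m: "\<Delta> m \<le> 12 * J * X"
      by simp
    let ?s = "m - J + 1"
    have s: "?s \<le> m" "m \<le> ?s + 2 * J"
      using m J by auto
    have "\<mu>\<^sup>2 * c * \<Delta> m \<le> \<mu>\<^sup>2 * c * (12 * J * X)"
      using \<Delta>m c by (intro mult_left_mono) auto
    then have \<Delta>': "\<mu>\<^sup>2 * c * \<Delta> m \<le> \<mu> * (\<mu> * (12 * c * J)) * X"
      by (simp add: power2_eq_square algebra_simps)
    \<comment> \<open>The budget behind the 5 in the rate: a decay of \<mu>\<nu>, minus 2/5
      \<mu>\<nu> for the input from \<open>b\<close> and \<open>d\<close> and 2/5 \<mu>\<nu> for the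
      motion term, leaves \<mu>\<nu>/5.\<close>
    have "a i \<le> (1 - \<mu> * \<nu> / 5) * X"
    proof -
      have "(1 - \<mu> * \<nu>) * a m \<le> (1 - \<mu> * \<nu>) * X"
        using \<mu>\<nu> IHm by (intro mult_left_mono) auto
      moreover have "\<mu> * c * (b ?s + d ?s) \<le> \<mu> * (2/5 * \<nu>) * X"
      proof -
        have "b ?s + d ?s \<le> 2 * \<beta> * (q * X)"
        proof -
          have "\<kappa> * (q * X) \<le> \<beta> * (q * X)"
            using q X by (intro mult_right_mono \<kappa>) auto
          then show ?thesis
            using IHb[OF s] IHd[OF s] by linarith
        qed
        also have "\<dots> \<le> 2 * \<beta> * (2 * X)"
          using \<beta> qX by (intro mult_left_mono) auto
        finally have "c * (b ?s + d ?s) \<le> c * (2 * \<beta> * (2 * X))"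
          using c by (intro mult_left_mono) auto
        also have "\<dots> = 10 * c * \<beta> * (2/5 * X)"
          by simp
        also have "\<dots> \<le> \<nu> * (2/5 * X)"
          using X by (intro mult_right_mono \<beta>) auto
        finally show ?thesis
          using mult_left_mono[of "c * (b ?s + d ?s)" "\<nu> * (2/5 * X)" \<mu>] \<mu> by (simp add: mult_ac)
      qed
      moreover have "\<mu> * (\<mu> * (12 * c * J)) * X \<le> \<mu> * (2/5 * \<nu>) * X"
        using small(2) \<mu> X by (intro mult_right_mono mult_left_mono) auto
      ultimately have "a i \<le> (1 - \<mu> * \<nu>) * X + \<mu> * (2/5 * \<nu>) * X + \<mu> * (2/5 * \<nu>) * X"
        using a[OF m(2)] \<Delta>' unfolding m(1) by linarith
      then show ?thesis
        by (simp add: algebra_simps)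
    qed
    \<comment> \<open>Of the decay 1/N, the delayed \<open>b\<close> takes back (1 + \<theta>)/(2N)
      and \<open>d\<close> takes (1 - \<theta>)/(4N). A margin of (1 - \<theta>)/(4N) remains, which
      dominates \<mu>\<nu>/5.\<close>
    moreover have "b i \<le> \<beta> * ((1 - \<mu> * \<nu> / 5) * X)"
    proof -
      have "(1 - 1 / N) * b m \<le> (1 - 1 / N) * (\<beta> * X)"
        using IHm N by (intro mult_left_mono) auto
      moreover have "\<theta> / N * b ?s \<le> (1 + \<theta>) / (2 * N) * (\<beta> * X)"
      proof -
        have "\<theta> / N * b ?s \<le> \<theta> / N * (\<beta> * (q * X))"
          using IHb[OF s] \<theta> N by (intro mult_left_mono) auto
        also have "\<dots> = (2 * (\<theta> * q)) / (2 * N) * (\<beta> * X)"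
          by simp
        also have "\<dots> \<le> (1 + \<theta>) / (2 * N) * (\<beta> * X)"
          using q(3) N \<beta> X by (intro mult_right_mono divide_right_mono) auto
        finally show ?thesis .
      qed
      moreover have "c * d ?s \<le> (1 - \<theta>) / (4 * N) * (\<beta> * X)"
      proof -
        have "d ?s \<le> \<kappa> * (2 * X)"
          using IHd[OF s] mult_left_mono[OF qX, of \<kappa>] \<kappa> by linarith
        then have "c * d ?s \<le> c * (\<kappa> * (2 * X))"
          using c by (intro mult_left_mono) auto
        also have "\<dots> = (8 * c * N * \<kappa>) * (X / (4 * N))"
          using N by simp
        also have "\<dots> \<le> \<beta> * (1 - \<theta>) * (X / (4 * N))"
          using X N by (intro mult_right_mono \<kappa>) auto
        finally show ?thesis
          by (simp add: mult_ac)
      qed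
      ultimately have "b i \<le> (1 - 1 / N) * (\<beta> * X) + (1 + \<theta>) / (2 * N) * (\<beta> * X)
          + (1 - \<theta>) / (4 * N) * (\<beta> * X)"
        using b[OF m(2)] unfolding m(1) by linarith
      also have "\<dots> = (1 - (1 - \<theta>) / (4 * N)) * (\<beta> * X)"
        using N by (simp add: field_simps)
      also have "\<dots> \<le> (1 - \<mu> * \<nu> / 5) * (\<beta> * X)"
      proof (intro mult_right_mono)
        show "1 - (1 - \<theta>) / (4 * N) \<le> 1 - \<mu> * \<nu> / 5"
          using small(1) \<mu>\<nu> by linarith
      qed (use \<beta> X in auto)
      finally show ?thesis
        by (simp add: mult_ac)
    qed
    \<comment> \<open>The motion term takes half of the decay 1/(2N).\<close>
    moreover have "d i \<le> \<kappa> * ((1 - \<mu> * \<nu> / 5) * X)"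
    proof -
      have "(1 - 1 / (2 * N)) * d m \<le> (1 - 1 / (2 * N)) * (\<kappa> * X)"
        using IHm N by (intro mult_left_mono) auto
      moreover have "\<mu> * (\<mu> * (12 * c * J)) * X \<le> 1 / (4 * N) * (\<kappa> * X)"
      proof -
        have "\<mu> * (\<mu> * (12 * c * J)) \<le> 1 * (\<mu> * (12 * c * J))"
          using \<mu> c by (intro mult_right_mono) auto
        also have "\<dots> \<le> 1 / (4 * N) * \<kappa>"
          using small(3) N by (simp add: field_simps)
        finally show ?thesis
          using X by (metis mult.assoc mult_right_mono)
      qed
      ultimately have "d i \<le> (1 - 1 / (2 * N)) * (\<kappa> * X) + 1 / (4 * N) * (\<kappa> * X)"
        using d[OF m(2)] \<Delta>' unfolding m(1) by linarith
      also have "\<dots> = (1 - 1 / (4 * N)) * (\<kappa> * X)"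
        using N by (simp add: field_simps)
      also have "\<dots> \<le> (1 - \<mu> * \<nu> / 5) * (\<kappa> * X)"
      proof (intro mult_right_mono)
        have "(1 - \<theta>) / (4 * N) \<le> 1 / (4 * N)"
          using \<theta> N by (intro divide_right_mono) auto
        then show "1 - 1 / (4 * N) \<le> 1 - \<mu> * \<nu> / 5"
          using small(1) \<mu>\<nu> by linarith
      qed (use \<kappa> X in auto)
      finally show ?thesis
        by (simp add: mult_ac)
    qed
    ultimately show ?thesis
      by (simp add: m X_def \<rho>_def mult_ac)
  qed
qed

text \<open>The ratios \<beta>, \<kappa> and the delay factor q depend only on the fixed constants,
  so the step-size bound can be chosen before the sequences. Only C depends on the
  sequences.\<close>

lemma delayed_recursion_linear_rate:
  fixes N c \<theta> \<nu> :: real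
  assumes J: "J \<ge> 1" and N: "N \<ge> 1" and c: "c \<ge> 1" and \<theta>: "0 < \<theta>" "\<theta> < 1" and \<nu>: "0 < \<nu>"
  shows "\<exists>\<mu>bar>0. \<mu>bar \<le> 1 \<and> \<mu>bar * \<nu> \<le> 1 \<and>
    (\<forall>\<mu> a b d. 0 < \<mu> \<longrightarrow> \<mu> \<le> \<mu>bar \<longrightarrow> (\<forall>i. 0 \<le> a i) \<longrightarrow> (\<forall>i. 0 \<le> b i) \<longrightarrow> (\<forall>i. 0 \<le> d i) \<longrightarrow>
      delayed_recursion J N c \<theta> \<nu> \<mu> a b d \<longrightarrow> (\<exists>C\<ge>0. \<forall>i. a i \<le> C * (1 - \<mu> * \<nu> / 5) ^ i))"
proof -
  define \<beta> where "\<beta> = min 1 (\<nu> / (10 * c))"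
  define \<kappa> where "\<kappa> = \<beta> * (1 - \<theta>) / (8 * c * N)"
  define q where "q = 1 + (1 - \<theta>) / 2"
  \<comment> \<open>Each entry is one smallness condition on \<mu> solved for \<mu>; the last one is
    for the Bernoulli estimate of the delay.\<close>
  define \<mu>bar where "\<mu>bar = Min {1, 1 / \<nu>, (1 - \<theta>) / (4 * N) / \<nu>, \<nu> / (30 * c * J),
    \<kappa> / (48 * c * J * N), (1 - 1 / q) / (2 * J * \<nu>)}"
  have \<beta>: "0 < \<beta>" "\<beta> \<le> 1" "10 * c * \<beta> \<le> \<nu>"
    using \<nu> c by (auto simp: \<beta>_def min_def field_simps)
  have "1 \<le> 8 * c * N"
    using mult_mono[of 1 c 1 N] c N by simp
  then have \<kappa>: "0 < \<kappa>" "\<kappa> \<le> \<beta>" "8 * c * N * \<kappa> \<le> \<beta> * (1 - \<theta>)"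
  proof -
    assume *: "1 \<le> 8 * c * N"
    show "0 < \<kappa>"
      using \<beta> \<theta> c N by (simp add: \<kappa>_def)
    have "\<beta> * (1 - \<theta>) \<le> \<beta> * (8 * c * N)"
      using \<beta> \<theta> * by (intro mult_left_mono) auto
    then show "\<kappa> \<le> \<beta>"
      using c N unfolding \<kappa>_def by (subst pos_divide_le_eq) auto
    show "8 * c * N * \<kappa> \<le> \<beta> * (1 - \<theta>)"
      using c N unfolding \<kappa>_def by simp
  qed
  \<comment> \<open>Halving the gap between \<theta> and 1 in the choice of q turns the required
    inequality into minus a square.\<close>
  have "2 * (\<theta> * q) - (1 + \<theta>) = - ((1 - \<theta>)\<^sup>2)"
    by (simp add: q_def field_simps power2_eq_square)
  also have "\<dots> \<le> 0"
    by simp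
  finally have "2 * (\<theta> * q) \<le> 1 + \<theta>"
    by simp
  then have q: "1 < q" "q \<le> 2" "2 * (\<theta> * q) \<le> 1 + \<theta>"
    using \<theta> by (auto simp: q_def)
  have Jp: "0 < real J"
    using J by simp
  have pos: "0 < 1 - 1 / q" "0 < c" "0 < N"
    using q c N by auto
  have \<mu>bar: "0 < \<mu>bar"
    unfolding \<mu>bar_def using \<nu> \<theta> Jp \<kappa>(1) pos by (subst Min_gr_iff) auto
  have le: "\<mu>bar \<le> x" if "x \<in> {1, 1 / \<nu>, (1 - \<theta>) / (4 * N) / \<nu>, \<nu> / (30 * c * J),
    \<kappa> / (48 * c * J * N), (1 - 1 / q) / (2 * J * \<nu>)}" for x
    unfolding \<mu>bar_def using that by (intro Min_le) auto
  show ?thesis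
  proof (rule exI[of _ \<mu>bar], intro conjI allI impI)
    show "0 < \<mu>bar" "\<mu>bar \<le> 1"
      using \<mu>bar le[of 1] by auto
    show "\<mu>bar * \<nu> \<le> 1"
      using le[of "1 / \<nu>"] \<nu> by (simp add: field_simps)
  next
    fix \<mu> and a b d :: "nat \<Rightarrow> real"
    assume \<mu>: "0 < \<mu>" "\<mu> \<le> \<mu>bar"
      and "\<forall>i. 0 \<le> a i" "\<forall>i. 0 \<le> b i" "\<forall>i. 0 \<le> d i"
      and rec: "delayed_recursion J N c \<theta> \<nu> \<mu> a b d"
    then have nonneg: "\<And>i. 0 \<le> a i" "\<And>i. 0 \<le> b i" "\<And>i. 0 \<le> d i"
      by blast+
    have small: "\<mu> \<le> 1" "\<mu> * \<nu> \<le> 1" "\<mu> * \<nu> \<le> (1 - \<theta>) / (4 * N)" "\<mu> * (30 * c * J) \<le> \<nu>"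
      "\<mu> * (48 * c * J * N) \<le> \<kappa>" "\<mu> * (2 * J * \<nu>) \<le> 1 - 1 / q"
    proof -
      have "\<mu> \<le> 1" "\<mu> \<le> 1 / \<nu>" "\<mu> \<le> (1 - \<theta>) / (4 * N) / \<nu>" "\<mu> \<le> \<nu> / (30 * c * J)"
        "\<mu> \<le> \<kappa> / (48 * c * J * N)" "\<mu> \<le> (1 - 1 / q) / (2 * J * \<nu>)"
        by (rule order_trans[OF \<mu>(2) le]; simp)+
      moreover have "0 < 30 * c * J" "0 < 48 * c * J * N" "0 < 2 * J * \<nu>"
        using pos Jp \<nu> by auto
      ultimately show "\<mu> \<le> 1" "\<mu> * \<nu> \<le> 1" "\<mu> * \<nu> \<le> (1 - \<theta>) / (4 * N)" "\<mu> * (30 * c * J) \<le> \<nu>"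
        "\<mu> * (48 * c * J * N) \<le> \<kappa>" "\<mu> * (2 * J * \<nu>) \<le> 1 - 1 / q"
        using \<nu> by (simp_all only: pos_le_divide_eq)
    qed
    have \<rho>: "0 < 1 - \<mu> * \<nu> / 5"
      using small(2) by simp
    \<comment> \<open>Bernoulli's inequality makes the loss over a delay of \<open>2 * J\<close>
      linear in \<mu>, so that it stays above 1/q.\<close>
    have "1 + real (2 * J) * (- (\<mu> * \<nu> / 5)) \<le> (1 + (- (\<mu> * \<nu> / 5))) ^ (2 * J)"
      using small(2) by (intro Bernoulli_inequality) simp
    moreover have "1 / q \<le> 1 + real (2 * J) * (- (\<mu> * \<nu> / 5))"
    proof -
      have "0 \<le> \<mu> * (2 * J * \<nu>)"
        using \<mu> \<nu> by simp
      moreover have "real (2 * J) * (- (\<mu> * \<nu> / 5)) = - (\<mu> * (2 * J * \<nu>)) / 5"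
        by simp
      ultimately show ?thesis
        using small(6) by linarith
    qed
    ultimately have "1 / q \<le> (1 - \<mu> * \<nu> / 5) ^ (2 * J)"
      by simp
    then have q4: "1 \<le> q * (1 - \<mu> * \<nu> / 5) ^ (2 * J)"
      using q(1) by (simp add: pos_divide_le_eq mult.commute)
    \<comment> \<open>The finite initial stretch is covered by brute force. Dividing by \<kappa>,
      the smallest of 1, \<beta> and \<kappa>, lets one constant serve all three sequences.\<close>
    define C where "C = (\<Sum>i\<le>2 * J. (a i + b i + d i) / (\<kappa> * (1 - \<mu> * \<nu> / 5) ^ i))"
    have C: "C \<ge> 0"
      unfolding C_def using nonneg \<kappa>(1) \<rho>
      by (intro sum_nonneg divide_nonneg_nonneg add_nonneg_nonneg mult_nonneg_nonneg) auto
    have init: "a i + b i + d i \<le> \<kappa> * C * (1 - \<mu> * \<nu> / 5) ^ i" if "i \<le> 2 * J" for i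
    proof -
      have "(a i + b i + d i) / (\<kappa> * (1 - \<mu> * \<nu> / 5) ^ i) \<le> C"
        unfolding C_def using nonneg \<kappa>(1) \<rho> that
        by (intro member_le_sum divide_nonneg_nonneg add_nonneg_nonneg mult_nonneg_nonneg) auto
      then show ?thesis
        using \<kappa>(1) \<rho> by (simp add: field_simps)
    qed
    have init': "a i \<le> C * (1 - \<mu> * \<nu> / 5) ^ i \<and>
          b i \<le> \<beta> * C * (1 - \<mu> * \<nu> / 5) ^ i \<and> d i \<le> \<kappa> * C * (1 - \<mu> * \<nu> / 5) ^ i"
      if "i \<le> 2 * J" for i
    proof -
      let ?X = "C * (1 - \<mu> * \<nu> / 5) ^ i"
      have "0 \<le> ?X"
        using C \<rho> by simp
      then have "\<kappa> * ?X \<le> \<beta> * ?X" "\<beta> * ?X \<le> 1 * ?X"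
        using \<kappa> \<beta> by (intro mult_right_mono; simp)+
      then show ?thesis
        using init[OF that] nonneg(1)[of i] nonneg(2)[of i] nonneg(3)[of i] by (simp add: mult.assoc)
    qed
    have "a i \<le> C * (1 - \<mu> * \<nu> / 5) ^ i" for i
      using delayed_recursion_induct[OF J N c \<theta> \<mu>(1)
          small(1) \<nu> \<beta> \<kappa> less_imp_le[OF q(1)] q(2,3) q4 small(3,4,5) C rec init']
      by blast
    then show "\<exists>C\<ge>0. \<forall>i. a i \<le> C * (1 - \<mu> * \<nu> / 5) ^ i"
      using C by blast
  qed
qed

section \<open>Mean and deviation of vectors, norm inequalities\<close>

definition vmean :: "real^'k \<Rightarrow> real" where
  "vmean x = (\<Sum>k\<in>UNIV. x$k) / real CARD('k)"

text \<open>The orthogonal projection onto the zero-sum vectors, where the combination matrix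
  contracts.\<close>

definition cen :: "real^'k \<Rightarrow> real^'k" where
  "cen x = x - (\<chi> k. vmean x)"

lemma vmean_add: "vmean (x + y) = vmean x + vmean y"
  and vmean_diff: "vmean (x - y) = vmean x - vmean y"
  by (simp_all add: vmean_def sum.distrib sum_subtractf add_divide_distrib diff_divide_distrib)

lemma cen_add: "cen (x + y) = cen x + cen y"
  by (simp add: cen_def vmean_add vec_eq_iff)

lemma sum_cen: "(\<Sum>k\<in>UNIV. cen x $ k) = 0"
  by (simp add: cen_def vmean_def sum_subtractf)

lemma norm_cen_le: "norm (cen x) \<le> norm x"
proof -
  let ?m = "(\<chi> k. vmean x) :: real^'a"
  have "cen x \<bullet> ?m = vmean x * (\<Sum>k\<in>UNIV. cen x $ k)"
    by (simp add: inner_vec_def sum_distrib_left mult.commute)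
  then have "(norm (cen x + ?m))\<^sup>2 = (norm (cen x))\<^sup>2 + (norm ?m)\<^sup>2"
    by (intro norm_add_Pythagorean) (simp add: orthogonal_def sum_cen)
  then have "(norm (cen x))\<^sup>2 \<le> (norm x)\<^sup>2"
    by (simp add: cen_def)
  then show ?thesis
    by (rule power2_le_imp_le) simp
qed

lemma abs_vmean_le_norm:
  fixes x :: "real^'k"
  shows "\<bar>vmean x\<bar> \<le> norm x"
proof -
  have "\<bar>\<Sum>k\<in>UNIV. x$k\<bar> \<le> (\<Sum>k\<in>UNIV. \<bar>x$k\<bar>)"
    by (rule sum_abs)
  also have "\<dots> \<le> of_nat (card (UNIV :: 'k set)) * norm x"
    by (rule sum_bounded_above) (rule component_le_norm_cart)
  finally show ?thesis
    by (simp add: vmean_def field_simps)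
qed

lemma abs_component_diff_le: "\<bar>x$k - m\<bar> \<le> norm (cen x) + \<bar>vmean x - m\<bar>"
proof -
  have "\<bar>cen x $ k\<bar> \<le> norm (cen x)"
    by (rule component_le_norm_cart)
  then show ?thesis
    by (simp add: cen_def)
qed

lemma norm_le_card_mult:
  fixes x :: "real^'m"
  assumes "\<And>j. \<bar>x$j\<bar> \<le> B"
  shows "norm x \<le> real CARD('m) * B"
proof -
  have "norm x \<le> (\<Sum>j\<in>UNIV. \<bar>x$j\<bar>)"
    by (rule norm_le_l1_cart)
  also have "\<dots> \<le> of_nat (card (UNIV :: 'm set)) * B"
    by (rule sum_bounded_above) (rule assms)
  finally show ?thesis
    by simp
qed

text \<open>Convexity of the square with weights \<theta> and 1 - \<theta>; the gap is itself a
  square. Applied to a contraction by \<theta>, the weight uses up only one of the two powers of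
  \<theta> that squaring produces.\<close>

lemma square_sum_le_weighted:
  fixes x y \<theta> :: real
  assumes "0 < \<theta>" "\<theta> < 1"
  shows "(x + y)\<^sup>2 \<le> x\<^sup>2 / \<theta> + y\<^sup>2 / (1 - \<theta>)"
proof -
  have "x\<^sup>2 / \<theta> + y\<^sup>2 / (1 - \<theta>) - (x + y)\<^sup>2 = ((1 - \<theta>) * x - \<theta> * y)\<^sup>2 / (\<theta> * (1 - \<theta>))"
    using assms by (simp add: field_simps power2_eq_square)
  also have "\<dots> \<ge> 0"
    using assms by simp
  finally show ?thesis
    by simp
qed

lemma square_sum3_le: "((x::real) + y + z)\<^sup>2 \<le> 3 * (x\<^sup>2 + y\<^sup>2 + z\<^sup>2)"
proof -
  have "3 * (x\<^sup>2 + y\<^sup>2 + z\<^sup>2) - (x + y + z)\<^sup>2 = (x - y)\<^sup>2 + (y - z)\<^sup>2 + (x - z)\<^sup>2"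
    by (simp add: power2_eq_square algebra_simps)
  also have "\<dots> \<ge> 0"
    by simp
  finally show ?thesis
    by simp
qed

lemma neg_inner_le_weighted:
  fixes x y :: "'a::real_inner"
  assumes "0 < c"
  shows "- 2 * (x \<bullet> y) \<le> c * (norm x)\<^sup>2 + (norm y)\<^sup>2 / c"
proof -
  have "0 \<le> (norm (c *\<^sub>R x + y))\<^sup>2 / c"
    using assms by simp
  also have "(norm (c *\<^sub>R x + y))\<^sup>2 = c\<^sup>2 * (norm x)\<^sup>2 + 2 * c * (x \<bullet> y) + (norm y)\<^sup>2"
    unfolding power2_norm_eq_inner
    by (simp add: inner_add inner_commute power2_eq_square algebra_simps)
  also have "\<dots> / c = c * (norm x)\<^sup>2 + 2 * (x \<bullet> y) + (norm y)\<^sup>2 / c"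
    using assms by (simp add: field_simps power2_eq_square)
  finally show ?thesis
    by simp
qed

lemma norm_add_square_le:
  fixes x y :: "'a::real_normed_vector"
  shows "(norm (x + y))\<^sup>2 \<le> 2 * ((norm x)\<^sup>2 + (norm y)\<^sup>2)"
proof -
  have "(norm (x + y))\<^sup>2 \<le> (norm x + norm y)\<^sup>2"
    by (intro power_mono norm_triangle_ineq) simp
  also have "\<dots> \<le> 2 * ((norm x)\<^sup>2 + (norm y)\<^sup>2)"
    using square_sum_le_weighted[of "1/2" "norm x" "norm y"] by (simp add: field_simps)
  finally show ?thesis .
qed

lemma telescope_norm_square_le:
  fixes w :: "nat \<Rightarrow> 'a::real_normed_vector"
  assumes "s \<le> i"
  shows "(norm (w i - w s))\<^sup>2 \<le> real (i - s) * (\<Sum>j\<in>{s..<i}. (norm (w (Suc j) - w j))\<^sup>2)"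
proof -
  have "norm (w i - w s) = norm (\<Sum>j\<in>{s..<i}. w (Suc j) - w j)"
    using assms by (simp add: sum_Suc_diff')
  also have "\<dots> \<le> (\<Sum>j\<in>{s..<i}. norm (w (Suc j) - w j))"
    by (rule norm_sum)
  finally have "(norm (w i - w s))\<^sup>2 \<le> (\<Sum>j\<in>{s..<i}. norm (w (Suc j) - w j))\<^sup>2"
    by (rule power_mono) simp
  also have "\<dots> \<le> (\<Sum>j\<in>{s..<i}. (1::real)\<^sup>2) * (\<Sum>j\<in>{s..<i}. (norm (w (Suc j) - w j))\<^sup>2)"
    using Cauchy_Schwarz_ineq_sum[of "\<lambda>_. 1" "\<lambda>j. norm (w (Suc j) - w j)" "{s..<i}"] by simp
  finally show ?thesis
    by simp
qed

text \<open>The cross term is linear in the direction, so it sees only the average of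
  \<open>g\<close>; the spread of the directions enters with \<mu> squared.\<close>

lemma average_norm_square_step:
  fixes g :: "'n::finite \<Rightarrow> 'a::real_inner"
  shows "(\<Sum>n\<in>UNIV. (norm (x - \<mu> *\<^sub>R g n))\<^sup>2) / real CARD('n) =
    (norm x)\<^sup>2 - 2 * \<mu> * (x \<bullet> ((1 / real CARD('n)) *\<^sub>R (\<Sum>n\<in>UNIV. g n)))
      + \<mu>\<^sup>2 * ((\<Sum>n\<in>UNIV. (norm (g n))\<^sup>2) / real CARD('n))"
proof -
  have "(norm (x - \<mu> *\<^sub>R g n))\<^sup>2 = (norm x)\<^sup>2 - 2 * \<mu> * (x \<bullet> g n) + \<mu>\<^sup>2 * (norm (g n))\<^sup>2" for n
    unfolding power2_norm_eq_inner
    by (simp add: inner_diff inner_commute power2_eq_square algebra_simps)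
  then show ?thesis
    by (simp add: sum.distrib sum_subtractf inner_sum_right add_divide_distrib diff_divide_distrib
        flip: sum_distrib_left)
qed

text \<open>A uniformly chosen entry is refreshed, so each entry survives with probability 1 -
  1/N.\<close>

lemma sum_fun_upd_average:
  fixes f g :: "'n::finite \<Rightarrow> real"
  shows "(\<Sum>n'\<in>UNIV. \<Sum>n\<in>UNIV. if n = n' then g n else f n) / real CARD('n) =
    (1 - 1 / real CARD('n)) * (\<Sum>n\<in>UNIV. f n) + (\<Sum>n\<in>UNIV. g n) / real CARD('n)"
proof -
  have "(\<Sum>n\<in>UNIV. if n = n' then g n else f n) = (\<Sum>n\<in>UNIV. f n) - f n' + g n'" for n'
    by (subst (1 2) sum.remove[of UNIV n']) (auto intro!: sum.cong)
  then have "(\<Sum>n'\<in>UNIV. \<Sum>n\<in>UNIV. if n = n' then g n else f n) =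
      (\<Sum>n'\<in>UNIV. (\<Sum>n\<in>UNIV. f n) - f n' + g n')"
    by (intro sum.cong refl)
  also have "\<dots> = real CARD('n) * (\<Sum>n\<in>UNIV. f n) - (\<Sum>n\<in>UNIV. f n) + (\<Sum>n\<in>UNIV. g n)"
    by (simp add: sum.distrib sum_subtractf)
  finally show ?thesis
    by (simp add: field_simps)
qed

section \<open>One step of the algorithm\<close>

text \<open>Local vectors live in the full space, but \<open>gr k\<close> reads and writes only the coordinates of
  block \<open>k\<close>; the blocks of all agents are therefore glued into the single vector \<open>wv\<close> below.\<close>

locale pvrd =
  fixes A :: "real^'k::finite^'k" and blk :: "'m::finite \<Rightarrow> 'k"
    and h :: "'n::finite \<Rightarrow> real^'m" and \<gamma> :: "'n \<Rightarrow> real"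
    and dQ :: "real \<Rightarrow> real \<Rightarrow> real" and gr :: "'k \<Rightarrow> real^'m \<Rightarrow> real^'m"
    and J :: nat and \<delta> \<eta> \<nu> \<theta> :: real and wstar :: "real^'m"
  assumes dQ_lip: "\<bar>dQ z1 (\<gamma> n) - dQ z2 (\<gamma> n)\<bar> \<le> \<delta> * \<bar>z1 - z2\<bar>"
    and gr_support: "blk j \<noteq> k \<Longrightarrow> gr k x $ j = 0"
    and gr_local: "(\<And>j. blk j = k \<Longrightarrow> x$j = y$j) \<Longrightarrow> gr k x = gr k y"
    and gr_lip: "norm ((\<Sum>k\<in>UNIV. gr k x) - (\<Sum>k\<in>UNIV. gr k y)) \<le> \<eta> * norm (x - y)"
    and strong: "\<nu> * (norm (w1 - w2))\<^sup>2 \<le>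
          (((1 / real CARD('n)) *\<^sub>R (\<Sum>n\<in>UNIV. dQ (h n \<bullet> w1) (\<gamma> n) *\<^sub>R h n) + (\<Sum>k\<in>UNIV. gr k w1))
         - ((1 / real CARD('n)) *\<^sub>R (\<Sum>n\<in>UNIV. dQ (h n \<bullet> w2) (\<gamma> n) *\<^sub>R h n) + (\<Sum>k\<in>UNIV. gr k w2)))
          \<bullet> (w1 - w2)"
    and stationary:
      "(1 / real CARD('n)) *\<^sub>R (\<Sum>n\<in>UNIV. dQ (h n \<bullet> wstar) (\<gamma> n) *\<^sub>R h n) + (\<Sum>k\<in>UNIV. gr k wstar) = 0"
    and pos: "\<delta> > 0" "\<eta> \<ge> 0" "\<nu> > 0" "J \<ge> 1" "0 < \<theta>" "\<theta> < 1"
    and A_sym: "transpose A = A" and A_stoch: "A *v (\<chi> k. 1) = (\<chi> k. 1)"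
    and A_contr: "(\<Sum>k\<in>UNIV. z$k) = 0 \<Longrightarrow> norm (A *v z) \<le> \<theta> * norm z"
begin

definition gradR :: "real^'m \<Rightarrow> real^'m" where
  "gradR x = (1 / real CARD('n)) *\<^sub>R (\<Sum>n\<in>UNIV. dQ (h n \<bullet> x) (\<gamma> n) *\<^sub>R h n) + (\<Sum>k\<in>UNIV. gr k x)"

definition wv :: "('m,'k,'n) pvrd_state \<Rightarrow> real^'m" where
  "wv S = (\<chi> j. fst S (blk j) $ j)"

definition uv :: "('m,'k,'n) pvrd_state \<Rightarrow> 'n \<Rightarrow> real^'k" where
  "uv S n = (\<chi> k. fst (snd S) k n)"

definition vv :: "('m,'k,'n) pvrd_state \<Rightarrow> 'n \<Rightarrow> real^'k" where
  "vv S n = (\<chi> k. snd (snd S) k n)"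

definition pv :: "'n \<Rightarrow> real^'m \<Rightarrow> real^'k" where
  "pv n x = (\<chi> k. real CARD('k) * blkdot blk k (h n) x)"

definition zz :: "('m,'k,'n) pvrd_state \<Rightarrow> 'n \<Rightarrow> real^'k" where
  "zz S n = (\<chi> k. (combine A ^^ J) (pvrd_z0 blk h n S) k)"

text \<open>The update directions of all agents as one vector. Tables and regularizer are taken from
  the current state \<open>S\<close>, the fresh prediction from the state \<open>S'\<close> in which
  the sample entered the pipeline.\<close>

definition ghat :: "'n \<Rightarrow> ('m,'k,'n) pvrd_state \<Rightarrow> ('m,'k,'n) pvrd_state \<Rightarrow> real^'m" where
  "ghat n' S S' = (\<chi> j. (dQ (zz S' n' $ blk j) (\<gamma> n') - dQ (uv S n' $ blk j) (\<gamma> n')) * h n' $ j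
     + (1 / real CARD('n)) * (\<Sum>n\<in>UNIV. dQ (uv S n $ blk j) (\<gamma> n) * h n $ j) + (\<Sum>k\<in>UNIV. gr k (wv S)) $ j)"

abbreviation "step \<mu> n' S S' \<equiv> pvrd_next A blk h \<gamma> dQ gr J \<mu> n' S S'"

section \<open>Vector form of one update and the action of the network on it\<close>

lemma blkdot_wv: "blkdot blk k (h n) (fst S k) = blkdot blk k (h n) (wv S)"
  by (simp add: blkdot_def wv_def)

lemma gr_wv: "gr (blk j) (fst S (blk j)) $ j = (\<Sum>k\<in>UNIV. gr k (wv S)) $ j"
proof -
  have "(\<Sum>k\<in>UNIV. gr k (wv S)) $ j = (\<Sum>k\<in>{blk j}. gr k (wv S) $ j)"
    unfolding sum_component by (rule sum.mono_neutral_right) (auto intro: gr_support)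
  moreover have "gr (blk j) (fst S (blk j)) = gr (blk j) (wv S)"
    by (rule gr_local) (simp add: wv_def)
  ultimately show ?thesis
    by simp
qed

lemma wv_step: "wv (step \<mu> n' S S') = wv S - \<mu> *\<^sub>R ghat n' S S'"
  unfolding vec_eq_iff
proof
  fix j
  obtain W U V where S: "S = (W, U, V)"
    by (cases S)
  show "wv (step \<mu> n' S S') $ j = (wv S - \<mu> *\<^sub>R ghat n' S S') $ j"
    using gr_wv[of j S]
    by (simp add: S wv_def ghat_def zz_def uv_def pvrd_next_def Let_def blkvec_def)
qed

lemma uv_step: "uv (step \<mu> n' S S') n = (if n = n' then zz S' n else uv S n)"
  by (cases S) (simp add: uv_def zz_def pvrd_next_def Let_def vec_eq_iff)

lemma vv_step: "vv (step \<mu> n' S S') n = (if n = n' then pv n (wv S') else vv S n)"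
  using blkdot_wv[of _ _ S']
  by (cases S; cases S') (simp add: vv_def pv_def pvrd_next_def Let_def pvrd_p_def vec_eq_iff)

lemma pv_diff: "pv n (x - y) = pv n x - pv n y"
  by (simp add: pv_def blkdot_def vec_eq_iff algebra_simps sum_subtractf)

lemma linear_pv: "linear (pv n)"
  by (rule linearI)
    (simp_all add: pv_def blkdot_def vec_eq_iff algebra_simps sum.distrib sum_distrib_left)

lemma vmean_pv: "vmean (pv n x) = h n \<bullet> x"
proof -
  have "(\<Sum>k\<in>UNIV. blkdot blk k (h n) x) = (\<Sum>j\<in>UNIV. h n $ j * x $ j)"
    unfolding blkdot_def using sum.group[of UNIV UNIV blk "\<lambda>j. h n $ j * x $ j"] by simp
  then show ?thesis
    by (simp add: vmean_def pv_def inner_vec_def flip: sum_distrib_left)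
qed

lemma combine_eq: "(\<chi> k. combine A z k) = A *v (\<chi> k. z k)"
proof -
  have "A $ l $ k = A $ k $ l" for k l
    using A_sym by (metis transpose_def vec_lambda_beta)
  then show ?thesis
    by (simp add: combine_def matrix_vector_mult_def)
qed

lemma combine_funpow_eq: "(\<chi> k. (combine A ^^ i) z k) = (((*v) A) ^^ i) (\<chi> k. z k)"
  by (induction i) (simp_all add: combine_eq)

lemma zz_eq: "zz S n = (((*v) A) ^^ J) (uv S n + (pv n (wv S) - vv S n))"
proof -
  have "(\<chi> k. pvrd_z0 blk h n S k) = uv S n + (pv n (wv S) - vv S n)"
    using blkdot_wv[of _ _ S]
    by (cases S) (simp add: vec_eq_iff pvrd_z0_def uv_def pv_def vv_def)
  then show ?thesis
    by (simp add: zz_def combine_funpow_eq)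
qed

lemma vmean_mult: "vmean (A *v x) = vmean x"
proof -
  have "(\<chi> k. 1) \<bullet> (A *v x) = (A *v (\<chi> k. 1)) \<bullet> x"
    by (metis dot_lmul_matrix A_sym transpose_matrix_vector)
  then show ?thesis
    by (simp add: A_stoch) (simp add: vmean_def inner_vec_def)
qed

lemma cen_mult: "cen (A *v x) = A *v cen x"
proof -
  have "A *v (\<chi> k. vmean x) = A *v (vmean x *\<^sub>R (\<chi> k. 1))"
    by (simp add: scaleR_vec_def)
  also have "\<dots> = (\<chi> k. vmean x)"
    by (simp only: matrix_vector_mult_scaleR A_stoch) (simp add: vec_eq_iff)
  finally show ?thesis
    by (simp add: cen_def vmean_mult matrix_vector_mult_diff_distrib)
qed

lemma vmean_funpow: "vmean ((((*v) A) ^^ i) x) = vmean x"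
  by (induction i) (simp_all add: vmean_mult)

lemma norm_cen_funpow_le: "norm (cen ((((*v) A) ^^ i) x)) \<le> \<theta> ^ i * norm (cen x)"
proof (induction i)
  case (Suc i)
  have "norm (cen ((((*v) A) ^^ Suc i) x)) \<le> \<theta> * norm (cen ((((*v) A) ^^ i) x))"
    by (simp add: cen_mult A_contr sum_cen)
  also have "\<dots> \<le> \<theta> * (\<theta> ^ i * norm (cen x))"
    using Suc pos by (intro mult_left_mono) auto
  finally show ?case
    by simp
qed simp

text \<open>Averaging over the network preserves sums, so for a balanced state the mean of every
  \<open>z\<close> leaving the pipeline is the exact prediction \<open>h n \<bullet> w\<close>.\<close>

definition balanced :: "('m,'k,'n) pvrd_state \<Rightarrow> bool" where
  "balanced S \<longleftrightarrow> (\<forall>n. vmean (uv S n) = vmean (vv S n))"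

lemma vmean_zz: "balanced S \<Longrightarrow> vmean (zz S n) = h n \<bullet> wv S"
  by (simp add: zz_eq vmean_funpow vmean_add vmean_diff vmean_pv balanced_def)

text \<open>The refreshed entries of both tables have the same mean, the exact prediction
  \<open>h n' \<bullet> wv S'\<close>.\<close>

lemma balanced_step: "balanced S \<Longrightarrow> balanced S' \<Longrightarrow> balanced (step \<mu> n' S S')"
  using vmean_zz[of S'] by (simp add: balanced_def uv_step vv_step vmean_pv)

lemma norm_cen_zz_le:
  "norm (cen (zz S n)) \<le> \<theta> * (norm (cen (uv S n)) + norm (pv n (wv S) - vv S n))"
proof -
  let ?x = "uv S n + (pv n (wv S) - vv S n)"
  have "norm (cen (zz S n)) \<le> \<theta> ^ J * norm (cen ?x)"
    unfolding zz_eq by (rule norm_cen_funpow_le)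
  \<comment> \<open>As \<open>J \<ge> 1\<close>, the power can be weakened to a single factor
    \<theta>.\<close>
  also have "\<dots> \<le> \<theta> * norm (cen ?x)"
    using pos power_decreasing[of 1 J \<theta>] by (intro mult_right_mono) auto
  also have "norm (cen ?x) \<le> norm (cen (uv S n)) + norm (cen (pv n (wv S) - vv S n))"
    unfolding cen_add by (rule norm_triangle_ineq)
  also have "\<dots> \<le> norm (cen (uv S n)) + norm (pv n (wv S) - vv S n)"
    by (simp add: norm_cen_le)
  finally show ?thesis
    using pos by simp
qed

section \<open>Squared errors and Lipschitz bounds in terms of them\<close>

definition ea :: "('m,'k,'n) pvrd_state \<Rightarrow> real" where
  "ea S = (norm (wv S - wstar))\<^sup>2"

definition eb :: "('m,'k,'n) pvrd_state \<Rightarrow> real" where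
  "eb S = (\<Sum>n\<in>UNIV. (norm (cen (uv S n)))\<^sup>2)"

definition ed :: "('m,'k,'n) pvrd_state \<Rightarrow> real" where
  "ed S = (\<Sum>n\<in>UNIV. (norm (pv n (wv S) - vv S n))\<^sup>2)"

definition ey :: "('m,'k,'n) pvrd_state \<Rightarrow> real" where
  "ey S = ea S + eb S + ed S"

lemma err_nonneg: "0 \<le> ea S" "0 \<le> eb S" "0 \<le> ed S" "0 \<le> ey S"
  by (simp_all add: ea_def eb_def ed_def ey_def sum_nonneg)

lemma norm_cen_uv_le: "norm (cen (uv S n)) \<le> sqrt (eb S)"
  unfolding eb_def by (intro real_le_rsqrt member_le_sum) auto

lemma norm_pv_vv_le: "norm (pv n (wv S) - vv S n) \<le> sqrt (ed S)"
  unfolding ed_def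
  by (intro real_le_rsqrt member_le_sum[of n UNIV "\<lambda>n. (norm (pv n (wv S) - vv S n))\<^sup>2"]) auto

lemma sqrt_err_le: "sqrt (ea S) \<le> sqrt (ey S)" "sqrt (eb S) \<le> sqrt (ey S)" "sqrt (ed S) \<le> sqrt (ey S)"
  using err_nonneg[of S] by (simp_all add: ey_def)

lemma norm_wv_le: "norm (wv S - wstar) \<le> sqrt (ey S)"
  using sqrt_err_le(1)[of S] by (simp add: ea_def)

text \<open>A sum rather than a maximum: any bound uniform in \<open>n\<close> serves.\<close>

definition hmax :: real where
  "hmax = (\<Sum>n\<in>UNIV. norm (h n))"

definition pmax :: real where
  "pmax = (\<Sum>n\<in>UNIV. onorm (pv n))"

lemma norm_h_le: "norm (h n) \<le> hmax"
  unfolding hmax_def by (rule member_le_sum) auto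

lemma hmax_nonneg: "0 \<le> hmax"
  unfolding hmax_def by (rule sum_nonneg) auto

lemma abs_h_le: "\<bar>h n $ j\<bar> \<le> hmax"
  using component_le_norm_cart[of "h n" j] norm_h_le[of n] by simp

lemma inner_h_le: "\<bar>h n \<bullet> x - h n \<bullet> y\<bar> \<le> hmax * norm (x - y)"
proof -
  have "\<bar>h n \<bullet> x - h n \<bullet> y\<bar> \<le> norm (h n) * norm (x - y)"
    by (metis Cauchy_Schwarz_ineq2 inner_diff_right)
  also have "\<dots> \<le> hmax * norm (x - y)"
    by (intro mult_right_mono norm_h_le) auto
  finally show ?thesis .
qed

lemma norm_pv_le: "norm (pv n x) \<le> pmax * norm x"
proof -
  have bl: "bounded_linear (pv n)" for n
    using linear_pv linear_linear by blast
  have "norm (pv n x) \<le> onorm (pv n) * norm x"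
    by (rule onorm[OF bl])
  also have "\<dots> \<le> pmax * norm x"
    unfolding pmax_def by (intro mult_right_mono member_le_sum) (auto intro: onorm_pos_le bl)
  finally show ?thesis .
qed

lemma norm_pv_square_le: "(norm (pv n x))\<^sup>2 \<le> pmax\<^sup>2 * (norm x)\<^sup>2"
  by (metis norm_pv_le norm_ge_zero power_mono power_mult_distrib)

text \<open>An entry differs from its network mean by at most the root of \<open>eb\<close>. By
  balance that mean is the mean of the \<open>v\<close> entries, which is stale by at most the root
  of \<open>ed\<close>; the remaining distance of \<open>w\<close> to the minimizer costs the factor
  \<open>hmax\<close>.\<close>

lemma uv_error_le:
  assumes "balanced S"
  shows "\<bar>uv S n $ k - h n \<bullet> wstar\<bar> \<le> (2 + hmax) * sqrt (ey S)"
proof -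
  have "vmean (uv S n) - h n \<bullet> wstar = - vmean (pv n (wv S) - vv S n) + (h n \<bullet> wv S - h n \<bullet> wstar)"
    using assms by (simp add: balanced_def vmean_diff vmean_pv)
  then have "\<bar>vmean (uv S n) - h n \<bullet> wstar\<bar> \<le> sqrt (ey S) + hmax * sqrt (ey S)"
    using abs_vmean_le_norm[of "pv n (wv S) - vv S n"] norm_pv_vv_le[of n S] sqrt_err_le(3)[of S]
      inner_h_le[of n "wv S" wstar] mult_left_mono[OF norm_wv_le hmax_nonneg, of S] by linarith
  then show ?thesis
    using abs_component_diff_le[of "uv S n" k "h n \<bullet> wstar"] norm_cen_uv_le[of S n] sqrt_err_le(2)[of S]
    unfolding distrib_right by linarith
qed

lemma norm_cen_zz_le': "norm (cen (zz S n)) \<le> sqrt (eb S) + sqrt (ed S)"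
proof -
  have "norm (cen (zz S n)) \<le> \<theta> * (norm (cen (uv S n)) + norm (pv n (wv S) - vv S n))"
    by (rule norm_cen_zz_le)
  also have "\<dots> \<le> 1 * (norm (cen (uv S n)) + norm (pv n (wv S) - vv S n))"
    using pos by (intro mult_right_mono) auto
  finally show ?thesis
    using norm_cen_uv_le[of S n] norm_pv_vv_le[of n S] by simp
qed

lemma zz_error_le:
  assumes "balanced S"
  shows "\<bar>zz S n $ k - h n \<bullet> x\<bar> \<le> sqrt (eb S) + sqrt (ed S) + hmax * norm (wv S - x)"
  using abs_component_diff_le[of "zz S n" k "h n \<bullet> x"] norm_cen_zz_le'[of S n]
    inner_h_le[of n "wv S" x] by (simp add: vmean_zz[OF assms])

lemma zz_error_wstar_le:
  assumes "balanced S"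
  shows "\<bar>zz S n $ k - h n \<bullet> wstar\<bar> \<le> (2 + hmax) * sqrt (ey S)"
  using zz_error_le[OF assms, of n k wstar] sqrt_err_le[of S]
    mult_left_mono[OF norm_wv_le hmax_nonneg, of S] unfolding distrib_right by linarith

lemma abs_average_le:
  fixes f :: "'n \<Rightarrow> real"
  assumes "\<And>n. \<bar>f n\<bar> \<le> B"
  shows "\<bar>(1 / real CARD('n)) * (\<Sum>n\<in>UNIV. f n)\<bar> \<le> B"
proof -
  have "\<bar>\<Sum>n\<in>UNIV. f n\<bar> \<le> (\<Sum>n\<in>UNIV. \<bar>f n\<bar>)"
    by (rule sum_abs)
  also have "\<dots> \<le> of_nat (card (UNIV :: 'n set)) * B"
    by (rule sum_bounded_above) (rule assms)
  finally show ?thesis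
    by (simp add: field_simps abs_mult)
qed

lemma dQ_h_diff_le:
  assumes "\<bar>z1 - z2\<bar> \<le> B"
  shows "\<bar>(dQ z1 (\<gamma> n) - dQ z2 (\<gamma> n)) * h n $ j\<bar> \<le> \<delta> * hmax * B"
proof -
  have "\<bar>dQ z1 (\<gamma> n) - dQ z2 (\<gamma> n)\<bar> \<le> \<delta> * B"
    using dQ_lip[of z1 n z2] mult_left_mono[OF assms, of \<delta>] pos by linarith
  then have "\<bar>dQ z1 (\<gamma> n) - dQ z2 (\<gamma> n)\<bar> * \<bar>h n $ j\<bar> \<le> \<delta> * B * hmax"
    by (intro mult_mono abs_h_le) auto
  then show ?thesis
    by (simp add: abs_mult mult_ac)
qed

definition cg :: real where
  "cg = 2 * (real CARD('m) * (2 * (\<delta> * hmax * (2 + hmax)) + \<eta>))\<^sup>2"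

lemma cg_nonneg: "0 \<le> cg"
  by (simp add: cg_def)

text \<open>Variance reduction: subtracting the stationarity equation at \<open>wstar\<close> leaves
  only Lipschitz differences, so the noisy direction itself vanishes with the errors. This is why a
  constant step-size can converge exactly.\<close>

lemma norm_ghat_square_le:
  assumes "balanced S" "balanced S'"
  shows "(norm (ghat n' S S'))\<^sup>2 \<le> cg * (ey S + ey S')"
proof -
  define y y' where "y = sqrt (ey S)" and "y' = sqrt (ey S')"
  define c1 where "c1 = \<delta> * hmax * (2 + hmax)"
  have nn: "0 \<le> y" "0 \<le> y'" "0 \<le> c1"
    using err_nonneg pos hmax_nonneg by (auto simp: y_def y'_def c1_def)
  have "\<bar>ghat n' S S' $ j\<bar> \<le> (2 * c1 + \<eta>) * (y + y')" for j
  proof -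
    let ?d = "\<lambda>n z. (dQ z (\<gamma> n) - dQ (h n \<bullet> wstar) (\<gamma> n)) * h n $ j"
    have "0 = (1 / real CARD('n)) * (\<Sum>n\<in>UNIV. dQ (h n \<bullet> wstar) (\<gamma> n) * h n $ j) + (\<Sum>k\<in>UNIV. gr k wstar) $ j"
      using arg_cong[OF stationary, of "\<lambda>v. v $ j"] by simp
    then have "ghat n' S S' $ j = ?d n' (zz S' n' $ blk j) - ?d n' (uv S n' $ blk j)
        + (1 / real CARD('n)) * (\<Sum>n\<in>UNIV. ?d n (uv S n $ blk j))
        + ((\<Sum>k\<in>UNIV. gr k (wv S)) - (\<Sum>k\<in>UNIV. gr k wstar)) $ j"
      by (simp add: ghat_def left_diff_distrib sum_subtractf right_diff_distrib diff_divide_distrib)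
    moreover have "\<bar>?d n' (zz S' n' $ blk j)\<bar> \<le> c1 * y'"
      using dQ_h_diff_le[OF zz_error_wstar_le[OF assms(2)]] by (simp add: c1_def y'_def mult.assoc)
    moreover have u: "\<bar>?d n (uv S n $ blk j)\<bar> \<le> c1 * y" for n
      using dQ_h_diff_le[OF uv_error_le[OF assms(1)]] by (simp add: c1_def y_def mult.assoc)
    moreover have "\<bar>(1 / real CARD('n)) * (\<Sum>n\<in>UNIV. ?d n (uv S n $ blk j))\<bar> \<le> c1 * y"
      by (rule abs_average_le) (rule u)
    moreover have "\<bar>((\<Sum>k\<in>UNIV. gr k (wv S)) - (\<Sum>k\<in>UNIV. gr k wstar)) $ j\<bar> \<le> \<eta> * y"
    proof -
      have "\<bar>((\<Sum>k\<in>UNIV. gr k (wv S)) - (\<Sum>k\<in>UNIV. gr k wstar)) $ j\<bar> \<le>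
          norm ((\<Sum>k\<in>UNIV. gr k (wv S)) - (\<Sum>k\<in>UNIV. gr k wstar))"
        by (rule component_le_norm_cart)
      also have "\<dots> \<le> \<eta> * norm (wv S - wstar)"
        by (rule gr_lip)
      also have "\<dots> \<le> \<eta> * y"
        unfolding y_def using pos by (intro mult_left_mono norm_wv_le) auto
      finally show ?thesis .
    qed
    ultimately have "\<bar>ghat n' S S' $ j\<bar> \<le> c1 * y' + c1 * y + c1 * y + \<eta> * y"
      using u[of n'] by linarith
    also have "\<dots> \<le> (2 * c1 + \<eta>) * (y + y')"
      using nn pos by (simp add: algebra_simps)
    finally show ?thesis .
  qed
  then have "norm (ghat n' S S') \<le> real CARD('m) * ((2 * c1 + \<eta>) * (y + y'))"
    by (rule norm_le_card_mult)
  then have "(norm (ghat n' S S'))\<^sup>2 \<le> (real CARD('m) * ((2 * c1 + \<eta>) * (y + y')))\<^sup>2"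
    by (rule power_mono) simp
  also have "\<dots> = (real CARD('m) * (2 * c1 + \<eta>))\<^sup>2 * (y + y')\<^sup>2"
    by (simp add: power_mult_distrib)
  also have "\<dots> \<le> (real CARD('m) * (2 * c1 + \<eta>))\<^sup>2 * (2 * (ey S + ey S'))"
    using norm_add_square_le[of y y'] err_nonneg
    by (intro mult_left_mono) (auto simp: y_def y'_def)
  also have "\<dots> = cg * (ey S + ey S')"
    by (simp add: cg_def c1_def)
  finally show ?thesis .
qed

lemma wv_increment_le:
  assumes "balanced S" "balanced S'"
  shows "(norm (wv (step \<mu> n' S S') - wv S))\<^sup>2 \<le> \<mu>\<^sup>2 * cg * (ey S + ey S')"
  using mult_left_mono[OF norm_ghat_square_le[OF assms], of "\<mu>\<^sup>2" n']
  by (simp add: wv_step power_mult_distrib mult.assoc)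

text \<open>Summing over \<open>n'\<close> cancels the table entries, so the mean update direction is the gradient of
  the risk up to consensus errors and the delay.\<close>

definition cb :: real where
  "cb = 3 * (real CARD('m) * (\<delta> * hmax))\<^sup>2 * (1 + hmax\<^sup>2)"

lemma cb_nonneg: "0 \<le> cb"
  by (simp add: cb_def)

lemma bias_square_le:
  assumes "balanced S'"
  shows "(norm ((1 / real CARD('n)) *\<^sub>R (\<Sum>n\<in>UNIV. ghat n S S') - gradR (wv S)))\<^sup>2
    \<le> cb * (eb S' + ed S' + (norm (wv S' - wv S))\<^sup>2)"
proof -
  let ?B = "(1 / real CARD('n)) *\<^sub>R (\<Sum>n\<in>UNIV. ghat n S S') - gradR (wv S)"
  let ?D = "norm (wv S' - wv S)"
  let ?E = "sqrt (eb S') + sqrt (ed S') + hmax * ?D"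
  have "\<bar>?B $ j\<bar> \<le> \<delta> * hmax * ?E" for j
  proof -
    have "?B $ j = (1 / real CARD('n)) * (\<Sum>n\<in>UNIV. (dQ (zz S' n $ blk j) (\<gamma> n) - dQ (h n \<bullet> wv S) (\<gamma> n)) * h n $ j)"
    proof -
      have "(\<Sum>n\<in>UNIV. ghat n S S') $ j = (\<Sum>n\<in>UNIV. dQ (zz S' n $ blk j) (\<gamma> n) * h n $ j)
          + real CARD('n) * (\<Sum>k\<in>UNIV. gr k (wv S)) $ j"
        by (simp add: ghat_def sum.distrib sum_subtractf left_diff_distrib)
      then show ?thesis
        by (simp add: gradR_def sum_subtractf left_diff_distrib field_simps)
    qed
    also have "\<bar>\<dots>\<bar> \<le> \<delta> * hmax * ?E"
      by (intro abs_average_le dQ_h_diff_le zz_error_le assms)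
    finally show ?thesis .
  qed
  then have "norm ?B \<le> real CARD('m) * (\<delta> * hmax * ?E)"
    by (rule norm_le_card_mult)
  then have "(norm ?B)\<^sup>2 \<le> (real CARD('m) * (\<delta> * hmax * ?E))\<^sup>2"
    by (rule power_mono) simp
  also have "\<dots> = (real CARD('m) * (\<delta> * hmax))\<^sup>2 * ?E\<^sup>2"
    by (simp add: power_mult_distrib)
  also have "\<dots> \<le> (real CARD('m) * (\<delta> * hmax))\<^sup>2 * (3 * ((1 + hmax\<^sup>2) * (eb S' + ed S' + ?D\<^sup>2)))"
  proof (rule mult_left_mono)
    have "?E\<^sup>2 \<le> 3 * ((sqrt (eb S'))\<^sup>2 + (sqrt (ed S'))\<^sup>2 + (hmax * ?D)\<^sup>2)"
      by (rule square_sum3_le)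
    also have "\<dots> = 3 * (eb S' + ed S' + hmax\<^sup>2 * ?D\<^sup>2)"
      by (simp add: err_nonneg power_mult_distrib)
    also have "\<dots> \<le> 3 * ((1 + hmax\<^sup>2) * (eb S' + ed S' + ?D\<^sup>2))"
      using err_nonneg[of S'] by (simp add: algebra_simps)
    finally show "?E\<^sup>2 \<le> 3 * ((1 + hmax\<^sup>2) * (eb S' + ed S' + ?D\<^sup>2))" .
  qed simp
  finally show ?thesis
    by (simp add: cb_def mult_ac)
qed

text \<open>Strong monotonicity contributes a decay of 2\<mu>\<nu>. The inner product with the bias
  is split with weight \<nu>, which gives back \<mu>\<nu> and leaves the squared bias divided by
  \<nu>.\<close>

lemma average_ea_step:
  assumes "balanced S" "balanced S'" and \<mu>: "0 < \<mu>"
  shows "(\<Sum>n\<in>UNIV. ea (step \<mu> n S S')) / real CARD('n) \<le> (1 - \<mu> * \<nu>) * ea S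
    + \<mu> * (cb / \<nu>) * (eb S' + ed S' + (norm (wv S' - wv S))\<^sup>2) + \<mu>\<^sup>2 * cg * (ey S + ey S')"
proof -
  let ?x = "wv S - wstar"
  let ?g = "(1 / real CARD('n)) *\<^sub>R (\<Sum>n\<in>UNIV. ghat n S S')"
  let ?B = "?g - gradR (wv S)"
  have "ea (step \<mu> n S S') = (norm (?x - \<mu> *\<^sub>R ghat n S S'))\<^sup>2" for n
    by (simp add: ea_def wv_step algebra_simps)
  then have "(\<Sum>n\<in>UNIV. ea (step \<mu> n S S')) / real CARD('n) = (norm ?x)\<^sup>2 - 2 * \<mu> * (?x \<bullet> ?g)
      + \<mu>\<^sup>2 * ((\<Sum>n\<in>UNIV. (norm (ghat n S S'))\<^sup>2) / real CARD('n))"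
    by (simp only: average_norm_square_step)
  moreover have "\<mu>\<^sup>2 * ((\<Sum>n\<in>UNIV. (norm (ghat n S S'))\<^sup>2) / real CARD('n)) \<le> \<mu>\<^sup>2 * (cg * (ey S + ey S'))"
  proof (rule mult_left_mono)
    have "(\<Sum>n\<in>UNIV. (norm (ghat n S S'))\<^sup>2) \<le> of_nat (card (UNIV :: 'n set)) * (cg * (ey S + ey S'))"
      by (rule sum_bounded_above) (rule norm_ghat_square_le[OF assms(1,2)])
    then show "(\<Sum>n\<in>UNIV. (norm (ghat n S S'))\<^sup>2) / real CARD('n) \<le> cg * (ey S + ey S')"
      by (simp add: field_simps)
  qed simp
  moreover have "- 2 * \<mu> * (?x \<bullet> ?g) \<le> - (\<mu> * \<nu>) * (norm ?x)\<^sup>2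
      + \<mu> * ((cb / \<nu>) * (eb S' + ed S' + (norm (wv S' - wv S))\<^sup>2))"
  proof -
    have "gradR wstar = 0"
      by (simp add: gradR_def stationary)
    then have "\<nu> * (norm ?x)\<^sup>2 \<le> ?x \<bullet> gradR (wv S)"
      using strong[of "wv S" wstar] unfolding gradR_def[symmetric] by (simp add: inner_commute)
    moreover have "- 2 * (?x \<bullet> ?B) \<le> \<nu> * (norm ?x)\<^sup>2 + (norm ?B)\<^sup>2 / \<nu>"
      using pos by (intro neg_inner_le_weighted)
    moreover have "(norm ?B)\<^sup>2 / \<nu> \<le> cb / \<nu> * (eb S' + ed S' + (norm (wv S' - wv S))\<^sup>2)"
      using divide_right_mono[OF bias_square_le[OF assms(2), of S], of \<nu>] pos by simp
    moreover have "?x \<bullet> ?g = ?x \<bullet> gradR (wv S) + ?x \<bullet> ?B"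
      by (simp flip: inner_add_right)
    ultimately have "- 2 * (?x \<bullet> ?g) \<le> - \<nu> * (norm ?x)\<^sup>2
        + (cb / \<nu>) * (eb S' + ed S' + (norm (wv S' - wv S))\<^sup>2)"
      by linarith
    then have "\<mu> * (- 2 * (?x \<bullet> ?g)) \<le> \<mu> * (- \<nu> * (norm ?x)\<^sup>2
        + (cb / \<nu>) * (eb S' + ed S' + (norm (wv S' - wv S))\<^sup>2))"
      using \<mu> by (intro mult_left_mono) auto
    then show ?thesis
      by (simp add: algebra_simps)
  qed
  ultimately show ?thesis
    by (simp add: ea_def left_diff_distrib mult.assoc)
qed

text \<open>One entry in N is replaced by a contracted one. The weighted square inequality keeps a
  factor \<theta> on \<open>eb S'\<close> and puts the rest on the staleness
  \<open>ed S'\<close>.\<close>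

lemma average_eb_step:
  "(\<Sum>n\<in>UNIV. eb (step \<mu> n S S')) / real CARD('n) \<le> (1 - 1 / real CARD('n)) * eb S + \<theta> / real CARD('n) * eb S' + 1 / (1 - \<theta>) * ed S'"
proof -
  have card1: "real CARD('n) \<ge> 1"
    by (simp add: Suc_leI)
  have "eb (step \<mu> n' S S') = (\<Sum>n\<in>UNIV. if n = n' then (norm (cen (zz S' n)))\<^sup>2 else (norm (cen (uv S n)))\<^sup>2)" for n'
    unfolding eb_def uv_step by (rule sum.cong) auto
  then have "(\<Sum>n\<in>UNIV. eb (step \<mu> n S S')) / real CARD('n) =
      (1 - 1 / real CARD('n)) * eb S + (\<Sum>n\<in>UNIV. (norm (cen (zz S' n)))\<^sup>2) / real CARD('n)"
    by (simp only: sum_fun_upd_average) (simp add: eb_def)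
  also have "(\<Sum>n\<in>UNIV. (norm (cen (zz S' n)))\<^sup>2) \<le> \<theta> * eb S' + 1 / (1 - \<theta>) * ed S'"
  proof -
    have "(norm (cen (zz S' n)))\<^sup>2 \<le> \<theta> * (norm (cen (uv S' n)))\<^sup>2 +
        1 / (1 - \<theta>) * (norm (pv n (wv S') - vv S' n))\<^sup>2" (is "_ \<le> \<theta> * ?u\<^sup>2 + _ * ?v\<^sup>2") for n
    proof -
      have "(norm (cen (zz S' n)))\<^sup>2 \<le> (\<theta> * (?u + ?v))\<^sup>2"
        by (intro power_mono norm_cen_zz_le) auto
      also have "\<dots> \<le> \<theta>\<^sup>2 * (?u\<^sup>2 / \<theta> + ?v\<^sup>2 / (1 - \<theta>))"
        using square_sum_le_weighted[of \<theta> ?u ?v] pos by (simp add: power_mult_distrib)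
      also have "\<dots> = \<theta> * ?u\<^sup>2 + \<theta>\<^sup>2 * (?v\<^sup>2 / (1 - \<theta>))"
        using pos by (simp add: field_simps power2_eq_square)
      also have "\<theta>\<^sup>2 * (?v\<^sup>2 / (1 - \<theta>)) \<le> 1 * (?v\<^sup>2 / (1 - \<theta>))"
        using pos by (intro mult_right_mono) (auto simp: power_le_one)
      finally show ?thesis
        by simp
    qed
    then have "(\<Sum>n\<in>UNIV. (norm (cen (zz S' n)))\<^sup>2) \<le> (\<Sum>n\<in>UNIV. \<theta> * (norm (cen (uv S' n)))\<^sup>2 +
        1 / (1 - \<theta>) * (norm (pv n (wv S') - vv S' n))\<^sup>2)"
      by (rule sum_mono)
    then show ?thesis
      by (simp only: sum.distrib sum_distrib_left[symmetric] eb_def ed_def)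
  qed
  also have "(\<theta> * eb S' + 1 / (1 - \<theta>) * ed S') / real CARD('n) \<le> \<theta> / real CARD('n) * eb S' + 1 / (1 - \<theta>) * ed S'"
  proof -
    have "1 / (1 - \<theta>) * ed S' / real CARD('n) \<le> 1 / (1 - \<theta>) * ed S' / 1"
      using card1 pos err_nonneg by (intro divide_left_mono) auto
    then show ?thesis
      by (simp add: add_divide_distrib)
  qed
  finally show ?thesis
    by (simp add: divide_right_mono)
qed

definition cd :: real where
  "cd = pmax\<^sup>2 * (real CARD('n) * (1 + 2 * real CARD('n)) + 2)"

lemma cd_nonneg: "0 \<le> cd"
  by (simp add: cd_def)

text \<open>The motion of \<open>w\<close> makes a surviving entry staler. Allowing a growth by 1 +
  1/(2N) still leaves a decay, since (1 - 1/N)(1 + 1/(2N)) \<le> 1 - 1/(2N). A refreshed entry is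
  stale only by the motion since its sample entered.\<close>

lemma average_ed_step:
  assumes "balanced S" "balanced S'"
  shows "(\<Sum>n\<in>UNIV. ed (step \<mu> n S S')) / real CARD('n) \<le> (1 - 1 / (2 * real CARD('n))) * ed S
    + cd * (\<mu>\<^sup>2 * cg * (ey S + ey S') + (norm (wv S' - wv S))\<^sup>2)"
proof -
  define \<Gamma> where "\<Gamma> = \<mu>\<^sup>2 * cg * (ey S + ey S')"
  define D where "D = (norm (wv S' - wv S))\<^sup>2"
  define t where "t n = (norm (pv n (wv S) - vv S n))\<^sup>2" for n
  have card1: "real CARD('n) \<ge> 1"
    by (simp add: Suc_leI)
  have \<Gamma>: "0 \<le> \<Gamma>" and D: "0 \<le> D"
    using cg_nonneg err_nonneg by (auto simp: \<Gamma>_def D_def)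
  have old: "(norm (pv n (wv (step \<mu> n' S S')) - vv S n))\<^sup>2 \<le>
      (1 + 1 / (2 * real CARD('n))) * t n + (1 + 2 * real CARD('n)) * (pmax\<^sup>2 * \<Gamma>)" for n n'
  proof -
    \<comment> \<open>The weight for which 1/\<tau> is the permitted growth 1 + 1/(2N).\<close>
    define \<tau> where "\<tau> = 2 * real CARD('n) / (1 + 2 * real CARD('n))"
    let ?w = "wv (step \<mu> n' S S')"
    have \<tau>: "0 < \<tau>" "\<tau> < 1" "1 / \<tau> = 1 + 1 / (2 * real CARD('n))" "1 / (1 - \<tau>) = 1 + 2 * real CARD('n)"
      using card1 by (auto simp: \<tau>_def field_simps)
    have "pv n ?w - vv S n = (pv n (wv S) - vv S n) + pv n (?w - wv S)"
      by (simp add: pv_diff)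
    then have "(norm (pv n ?w - vv S n))\<^sup>2 \<le> (norm (pv n (wv S) - vv S n) + norm (pv n (?w - wv S)))\<^sup>2"
      by (metis norm_triangle_ineq norm_ge_zero power_mono)
    also have "\<dots> \<le> t n / \<tau> + (norm (pv n (?w - wv S)))\<^sup>2 / (1 - \<tau>)"
      unfolding t_def by (rule square_sum_le_weighted[OF \<tau>(1,2)])
    also have "\<dots> = (1 + 1 / (2 * real CARD('n))) * t n + (1 + 2 * real CARD('n)) * (norm (pv n (?w - wv S)))\<^sup>2"
      unfolding \<tau>(3,4)[symmetric] by simp
    also have "\<dots> \<le> (1 + 1 / (2 * real CARD('n))) * t n + (1 + 2 * real CARD('n)) * (pmax\<^sup>2 * \<Gamma>)"
    proof -
      have "(norm (pv n (?w - wv S)))\<^sup>2 \<le> pmax\<^sup>2 * (norm (?w - wv S))\<^sup>2"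
        by (rule norm_pv_square_le)
      also have "\<dots> \<le> pmax\<^sup>2 * \<Gamma>"
        unfolding \<Gamma>_def by (intro mult_left_mono wv_increment_le assms) auto
      finally show ?thesis
        by (intro add_left_mono mult_left_mono) auto
    qed
    finally show ?thesis .
  qed
  have new: "(norm (pv n (wv (step \<mu> n' S S')) - pv n (wv S')))\<^sup>2 \<le> 2 * pmax\<^sup>2 * (\<Gamma> + D)" for n n'
  proof -
    let ?w = "wv (step \<mu> n' S S')"
    have "(norm (pv n ?w - pv n (wv S')))\<^sup>2 \<le> pmax\<^sup>2 * (norm ((?w - wv S) + (wv S - wv S')))\<^sup>2"
      using norm_pv_square_le[of n "?w - wv S'"] by (simp add: pv_diff)
    also have "\<dots> \<le> pmax\<^sup>2 * (2 * (\<Gamma> + D))"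
    proof (rule mult_left_mono)
      show "(norm ((?w - wv S) + (wv S - wv S')))\<^sup>2 \<le> 2 * (\<Gamma> + D)"
        using norm_add_square_le[of "?w - wv S" "wv S - wv S'"] wv_increment_le[OF assms, of \<mu> n']
        by (simp add: \<Gamma>_def D_def norm_minus_commute)
    qed simp
    finally show ?thesis
      by (simp add: algebra_simps)
  qed
  let ?o = "\<lambda>n. (1 + 1 / (2 * real CARD('n))) * t n + (1 + 2 * real CARD('n)) * (pmax\<^sup>2 * \<Gamma>)"
  let ?m = "2 * pmax\<^sup>2 * (\<Gamma> + D)"
  have "ed (step \<mu> n' S S') \<le> (\<Sum>n\<in>UNIV. if n = n' then ?m else ?o n)" for n'
    unfolding ed_def vv_step using old new by (intro sum_mono) auto
  then have "(\<Sum>n\<in>UNIV. ed (step \<mu> n S S')) / real CARD('n) \<le>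
      (\<Sum>n'\<in>UNIV. \<Sum>n\<in>UNIV. if n = n' then ?m else ?o n) / real CARD('n)"
    by (intro divide_right_mono sum_mono) auto
  also have "\<dots> = (1 - 1 / real CARD('n)) * (\<Sum>n\<in>UNIV. ?o n) + ?m"
    using card1 by (subst sum_fun_upd_average) simp
  also have "(\<Sum>n\<in>UNIV. ?o n) = (1 + 1 / (2 * real CARD('n))) * ed S + real CARD('n) * ((1 + 2 * real CARD('n)) * (pmax\<^sup>2 * \<Gamma>))"
    by (simp add: sum.distrib ed_def t_def flip: sum_distrib_left)
  also have "(1 - 1 / real CARD('n)) * \<dots> \<le> (1 - 1 / (2 * real CARD('n))) * ed S + real CARD('n) * ((1 + 2 * real CARD('n)) * (pmax\<^sup>2 * \<Gamma>))"
  proof -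
    have "(1 - 1 / real CARD('n)) * (1 + 1 / (2 * real CARD('n))) \<le> 1 - 1 / (2 * real CARD('n))"
      using card1 by (simp add: field_simps)
    then have "(1 - 1 / real CARD('n)) * ((1 + 1 / (2 * real CARD('n))) * ed S) \<le> (1 - 1 / (2 * real CARD('n))) * ed S"
      unfolding mult.assoc[symmetric] by (intro mult_right_mono err_nonneg)
    moreover have "(1 - 1 / real CARD('n)) * (real CARD('n) * ((1 + 2 * real CARD('n)) * (pmax\<^sup>2 * \<Gamma>))) \<le> 1 * (real CARD('n) * ((1 + 2 * real CARD('n)) * (pmax\<^sup>2 * \<Gamma>)))"
      using card1 \<Gamma> by (intro mult_right_mono) auto
    ultimately show ?thesis
      unfolding distrib_left[of "1 - 1 / real CARD('n)"] mult_1_left by linarith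
  qed
  also have "(1 - 1 / (2 * real CARD('n))) * ed S + real CARD('n) * ((1 + 2 * real CARD('n)) * (pmax\<^sup>2 * \<Gamma>)) + ?m \<le>
      (1 - 1 / (2 * real CARD('n))) * ed S + cd * (\<Gamma> + D)"
    using D by (simp add: cd_def algebra_simps)
  finally show ?thesis
    by (simp add: \<Gamma>_def D_def)
qed

end

section \<open>Expected errors along the iteration\<close>

context pvrd
begin

section \<open>The state sequence and its independence of recent samples\<close>

definition St :: "real \<Rightarrow> (nat \<Rightarrow> 'n) \<Rightarrow> nat \<Rightarrow> ('m,'k,'n) pvrd_state" where
  "St \<mu> ns i = pvrd_hist A blk h \<gamma> dQ gr J \<mu> ns i i"

text \<open>Stage \<open>Suc m\<close> of the history writes only at index \<open>m + 2\<close>, so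
  entry \<open>i\<close> is final from stage \<open>i - 1\<close> on.\<close>

lemma hist_eq_St: "i \<le> Suc m \<Longrightarrow> pvrd_hist A blk h \<gamma> dQ gr J \<mu> ns m i = St \<mu> ns i"
proof (induction m)
  case 0
  then show ?case
    by (cases i) (auto simp: St_def Let_def)
next
  case (Suc m)
  show ?case
  proof (cases "i \<le> Suc m")
    case True
    with Suc.IH show ?thesis
      by (simp add: Let_def)
  next
    case False
    with Suc.prems have "i = Suc (Suc m)"
      by simp
    then show ?thesis
      by (simp add: St_def Let_def)
  qed
qed

lemma St_0: "St \<mu> ns 0 = pvrd_init"
  by (simp add: St_def)

lemma St_Suc: "St \<mu> ns (Suc i) =
  (if i < J then St \<mu> ns i else step \<mu> (ns (i - J + 1)) (St \<mu> ns i) (St \<mu> ns (i - J + 1)))"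
proof (cases i)
  \<comment> \<open>As \<open>J \<ge> 1\<close>, \<open>i = 0\<close> belongs to the warm-up: states
    0 and 1 are both initial.\<close>
  case 0
  then show ?thesis
    using pos hist_eq_St[of "Suc 0" 0 \<mu> ns] by (simp add: St_0)
next
  case (Suc m)
  have "St \<mu> ns (Suc i) = pvrd_hist A blk h \<gamma> dQ gr J \<mu> ns i (Suc i)"
    by (rule hist_eq_St[symmetric]) simp
  then show ?thesis
    using Suc pos by (simp add: Let_def hist_eq_St)
qed

lemma St_warmup: "i < J \<Longrightarrow> St \<mu> ns (Suc i) = St \<mu> ns i"
  by (subst St_Suc) simp

lemma St_step: "J \<le> i \<Longrightarrow>
    St \<mu> ns (Suc i) = step \<mu> (ns (i - J + 1)) (St \<mu> ns i) (St \<mu> ns (i - J + 1))"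
  by (subst St_Suc) simp

lemma balanced_St: "balanced (St \<mu> ns i)"
proof (induction i rule: less_induct)
  case (less i)
  show ?case
  proof (cases i)
    case 0
    then show ?thesis
      by (simp add: St_0 balanced_def pvrd_init_def uv_def vv_def)
  next
    case (Suc j)
    show ?thesis
    proof (cases "j < J")
      case True
      then show ?thesis
        using less[of j] Suc by (simp add: St_warmup)
    next
      case False
      then have "j - J + 1 < i"
        using Suc pos(4) by auto
      then show ?thesis
        using less[of j] less[of "j - J + 1"] Suc False
        by (simp only: Suc St_step balanced_step not_less lessI)
    qed
  qed
qed

text \<open>The sample drawn at iteration \<open>s\<close> first influences the state at iteration \<open>s + J\<close>, so the
  sample leaving the pipeline at iteration \<open>i\<close> is independent of the state at iteration \<open>i\<close>.\<close>

lemma St_cong: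
  "(\<And>s. 1 \<le> s \<Longrightarrow> s \<le> i - J \<Longrightarrow> ns s = ns' s) \<Longrightarrow> St \<mu> ns i = St \<mu> ns' i"
proof (induction i rule: less_induct)
  case (less i)
  show ?case
  proof (cases i)
    case 0
    then show ?thesis
      by (simp add: St_0)
  next
    case (Suc j)
    show ?thesis
    proof (cases "j < J")
      case True
      have "St \<mu> ns j = St \<mu> ns' j"
        using Suc True by (intro less.IH less.prems) auto
      with Suc True show ?thesis
        by (simp only: St_warmup)
    next
      case False
      have "St \<mu> ns j = St \<mu> ns' j" "St \<mu> ns (j - J + 1) = St \<mu> ns' (j - J + 1)"
        using Suc False pos by (intro less.IH less.prems; simp)+
      moreover have "ns (j - J + 1) = ns' (j - J + 1)"
        using Suc False by (intro less.prems) auto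
      ultimately show ?thesis
        using Suc False by (simp only: St_step not_less)
    qed
  qed
qed

lemma expect_St:
  assumes "i - J \<le> m"
  shows "expect_paths m (\<lambda>ns. f (St \<mu> ns i)) = expect_paths i (\<lambda>ns. f (St \<mu> ns i))"
proof -
  have *: "expect_paths m' (\<lambda>ns. f (St \<mu> ns i)) = expect_paths (i - J) (\<lambda>ns. f (St \<mu> ns i))"
    if "i - J \<le> m'" for m'
    using that by (intro expect_paths_cong_dependence) (auto intro!: arg_cong[of _ _ f] St_cong)
  show ?thesis
    using *[OF assms] *[of i] by simp
qed

text \<open>On the horizon \<open>Suc (i - J)\<close> the last index is exactly the sample leaving
  the pipeline at \<open>i\<close>. Both states fed to \<open>step\<close> read only earlier
  indices, so averaging over it keeps them fixed.\<close>

lemma expect_step: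
  assumes "J \<le> i"
  shows "expect_paths (Suc i) (\<lambda>ns. f (St \<mu> ns (Suc i))) =
    expect_paths (i - J) (\<lambda>ns. (\<Sum>n\<in>UNIV. f (step \<mu> n (St \<mu> ns i) (St \<mu> ns (i - J + 1)))) / real CARD('n))"
proof -
  have "expect_paths (Suc i) (\<lambda>ns. f (St \<mu> ns (Suc i))) =
      expect_paths (Suc (i - J)) (\<lambda>ns. f (St \<mu> ns (Suc i)))"
    using assms by (intro expect_St[symmetric]) simp
  also have "\<dots> = expect_paths (i - J)
      (\<lambda>ns. (\<Sum>n\<in>UNIV. f (St \<mu> (ns(Suc (i - J) := n)) (Suc i))) / real CARD('n))"
    by (rule expect_paths_Suc)
  also have "\<dots> = expect_paths (i - J)
      (\<lambda>ns. (\<Sum>n\<in>UNIV. f (step \<mu> n (St \<mu> ns i) (St \<mu> ns (i - J + 1)))) / real CARD('n))"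
  proof -
    have "St \<mu> (ns(Suc (i - J) := n)) (Suc i) = step \<mu> n (St \<mu> ns i) (St \<mu> ns (i - J + 1))" for ns n
    proof -
      have "St \<mu> (ns(Suc (i - J) := n)) i = St \<mu> ns i"
        "St \<mu> (ns(Suc (i - J) := n)) (i - J + 1) = St \<mu> ns (i - J + 1)"
        by (intro St_cong fun_upd_other; use pos(4) in arith)+
      then show ?thesis
        using St_step[OF assms, of \<mu> "ns(Suc (i - J) := n)"] by simp
    qed
    then show ?thesis
      by simp
  qed
  finally show ?thesis .
qed

text \<open>The pathwise counterpart of \<Delta> in \<open>delayed_recursion\<close>.\<close>

definition drift :: "real \<Rightarrow> (nat \<Rightarrow> 'n) \<Rightarrow> nat \<Rightarrow> real" where
  "drift \<mu> ns i = (\<Sum>j\<in>{i - J + 1..i}. ey (St \<mu> ns j) + ey (St \<mu> ns (j - J + 1)))"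

lemma ey_le_drift: "ey (St \<mu> ns i) + ey (St \<mu> ns (i - J + 1)) \<le> drift \<mu> ns i" if "J \<le> i"
  unfolding drift_def using that pos err_nonneg
  by (intro member_le_sum[of i _ "\<lambda>j. ey (St \<mu> ns j) + ey (St \<mu> ns (j - J + 1))"]) (auto intro: add_nonneg_nonneg)

lemma drift_nonneg: "0 \<le> drift \<mu> ns i"
  unfolding drift_def by (intro sum_nonneg add_nonneg_nonneg err_nonneg)

lemma wv_delay_le:
  assumes "2 * J \<le> i"
  shows "(norm (wv (St \<mu> ns (i - J + 1)) - wv (St \<mu> ns i)))\<^sup>2 \<le> real J * (\<mu>\<^sup>2 * cg * drift \<mu> ns i)"
proof -
  let ?s = "i - J + 1"
  let ?w = "\<lambda>j. wv (St \<mu> ns j)"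
  have "(norm (?w i - ?w ?s))\<^sup>2 \<le> real (i - ?s) * (\<Sum>j\<in>{?s..<i}. (norm (?w (Suc j) - ?w j))\<^sup>2)"
    using assms pos by (intro telescope_norm_square_le) auto
  also have "\<dots> \<le> real J * (\<Sum>j\<in>{?s..<i}. (norm (?w (Suc j) - ?w j))\<^sup>2)"
    using assms by (intro mult_right_mono sum_nonneg) auto
  also have "(\<Sum>j\<in>{?s..<i}. (norm (?w (Suc j) - ?w j))\<^sup>2) \<le>
      (\<Sum>j\<in>{?s..<i}. \<mu>\<^sup>2 * cg * (ey (St \<mu> ns j) + ey (St \<mu> ns (j - J + 1))))"
  proof (rule sum_mono)
    fix j assume "j \<in> {?s..<i}"
    \<comment> \<open>The whole window lies past the warm-up, so every increment in it is a genuine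
      update.\<close>
    then have "J \<le> j"
      using assms pos(4) by auto
    then have "St \<mu> ns (Suc j) = step \<mu> (ns (j - J + 1)) (St \<mu> ns j) (St \<mu> ns (j - J + 1))"
      by (rule St_step)
    then show "(norm (?w (Suc j) - ?w j))\<^sup>2 \<le> \<mu>\<^sup>2 * cg * (ey (St \<mu> ns j) + ey (St \<mu> ns (j - J + 1)))"
      by (simp add: wv_increment_le balanced_St)
  qed
  also have "\<dots> \<le> (\<Sum>j\<in>{?s..i}. \<mu>\<^sup>2 * cg * (ey (St \<mu> ns j) + ey (St \<mu> ns (j - J + 1))))"
    using cg_nonneg err_nonneg by (intro sum_mono2) (auto intro: add_nonneg_nonneg)
  also have "\<dots> = \<mu>\<^sup>2 * cg * drift \<mu> ns i"
    by (simp add: drift_def sum_distrib_left)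
  finally show ?thesis
    by (simp add: norm_minus_commute mult_left_mono)
qed

text \<open>The sum of all constants of the three one-step bounds, so that a single coefficient fits
  \<open>delayed_recursion\<close>.\<close>

definition gain :: real where
  "gain = 1 + 1 / (1 - \<theta>) + cb / \<nu> + (cb / \<nu> * real J * cg + cg) + cd * cg * (1 + real J)"

lemma gain_ge:
  "1 \<le> gain" "1 / (1 - \<theta>) \<le> gain" "cb / \<nu> \<le> gain" "cb / \<nu> * real J * cg + cg \<le> gain"
  "cd * cg * (1 + real J) \<le> gain"
proof -
  have "0 \<le> 1 / (1 - \<theta>)" "0 \<le> cb / \<nu>" "0 \<le> cg" "0 \<le> cb / \<nu> * real J * cg" "0 \<le> cd * cg * (1 + real J)"
    using pos cb_nonneg cg_nonneg cd_nonneg by simp_all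
  then show "1 \<le> gain" "1 / (1 - \<theta>) \<le> gain" "cb / \<nu> \<le> gain" "cb / \<nu> * real J * cg + cg \<le> gain"
    "cd * cg * (1 + real J) \<le> gain"
    unfolding gain_def by linarith+
qed

section \<open>Pathwise one-step bounds with the delay absorbed into the drift\<close>

context
  fixes \<mu> :: real and ns :: "nat \<Rightarrow> 'n" and i :: nat and S S' :: "('m,'k,'n) pvrd_state"
  assumes \<mu>: "0 < \<mu>" "\<mu> \<le> 1" and i: "2 * J \<le> i"
    and S: "S = St \<mu> ns i" and S': "S' = St \<mu> ns (i - J + 1)"
begin

lemma path_ea: "(\<Sum>n\<in>UNIV. ea (step \<mu> n S S')) / real CARD('n) \<le> (1 - \<mu> * \<nu>) * ea S
    + \<mu> * gain * (eb S' + ed S') + \<mu>\<^sup>2 * gain * drift \<mu> ns i"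
proof -
  let ?D = "(norm (wv S' - wv S))\<^sup>2"
  have J: "J \<le> i"
    using i by simp
  have "(\<Sum>n\<in>UNIV. ea (step \<mu> n S S')) / real CARD('n) \<le> (1 - \<mu> * \<nu>) * ea S
    + \<mu> * (cb / \<nu>) * (eb S' + ed S' + ?D) + \<mu>\<^sup>2 * cg * (ey S + ey S')"
    using \<mu> unfolding S S' by (intro average_ea_step balanced_St)
  also have "\<mu> * (cb / \<nu>) * (eb S' + ed S' + ?D) = \<mu> * (cb / \<nu>) * (eb S' + ed S') + \<mu> * (cb / \<nu>) * ?D"
    by (rule distrib_left)
  also have "\<mu> * (cb / \<nu>) * (eb S' + ed S') \<le> \<mu> * gain * (eb S' + ed S')"
    using \<mu> gain_ge err_nonneg by (intro mult_right_mono mult_left_mono add_nonneg_nonneg) auto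
  \<comment> \<open>The squared delay already carries \<mu> squared; the extra factor \<mu> is
    dropped by \<open>\<mu> \<le> 1\<close>.\<close>
  also have "\<mu> * (cb / \<nu>) * ?D \<le> 1 * (cb / \<nu>) * (real J * (\<mu>\<^sup>2 * cg * drift \<mu> ns i))"
    using \<mu> pos cb_nonneg wv_delay_le[OF i] unfolding S S' by (intro mult_mono) auto
  also have "\<mu>\<^sup>2 * cg * (ey S + ey S') \<le> \<mu>\<^sup>2 * cg * drift \<mu> ns i"
    using cg_nonneg ey_le_drift[OF J] unfolding S S' by (intro mult_left_mono) auto
  finally have "(\<Sum>n\<in>UNIV. ea (step \<mu> n S S')) / real CARD('n) \<le> (1 - \<mu> * \<nu>) * ea S
    + \<mu> * gain * (eb S' + ed S') + (cb / \<nu> * real J * cg + cg) * (\<mu>\<^sup>2 * drift \<mu> ns i)"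
    by (simp add: algebra_simps)
  also have "(cb / \<nu> * real J * cg + cg) * (\<mu>\<^sup>2 * drift \<mu> ns i) \<le> gain * (\<mu>\<^sup>2 * drift \<mu> ns i)"
    using gain_ge drift_nonneg by (intro mult_right_mono) auto
  finally show ?thesis
    by (simp add: mult_ac)
qed

lemma path_eb: "(\<Sum>n\<in>UNIV. eb (step \<mu> n S S')) / real CARD('n) \<le> (1 - 1 / real CARD('n)) * eb S
    + \<theta> / real CARD('n) * eb S' + gain * ed S'"
  using average_eb_step[of \<mu> S S'] mult_right_mono[OF gain_ge(2) err_nonneg(3), of S'] by linarith

lemma path_ed: "(\<Sum>n\<in>UNIV. ed (step \<mu> n S S')) / real CARD('n) \<le> (1 - 1 / (2 * real CARD('n))) * ed S
    + \<mu>\<^sup>2 * gain * drift \<mu> ns i"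
proof -
  have J: "J \<le> i"
    using i by simp
  have "cd * (\<mu>\<^sup>2 * cg * (ey S + ey S') + (norm (wv S' - wv S))\<^sup>2) \<le>
      cd * (\<mu>\<^sup>2 * cg * drift \<mu> ns i + real J * (\<mu>\<^sup>2 * cg * drift \<mu> ns i))"
    using cd_nonneg cg_nonneg ey_le_drift[OF J] wv_delay_le[OF i]
    unfolding S S' by (intro mult_left_mono add_mono) auto
  also have "\<dots> = cd * cg * (1 + real J) * (\<mu>\<^sup>2 * drift \<mu> ns i)"
    by (simp add: algebra_simps)
  also have "\<dots> \<le> gain * (\<mu>\<^sup>2 * drift \<mu> ns i)"
    using gain_ge drift_nonneg by (intro mult_right_mono) auto
  finally show ?thesis
    using average_ed_step[OF balanced_St balanced_St, of \<mu> \<mu> ns i \<mu> ns "i - J + 1"]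
    unfolding S[symmetric] S'[symmetric] by (simp add: mult_ac)
qed

end

text \<open>Every state up to iteration \<open>i\<close> reads only the first \<open>i - J\<close>
  indices. Expectation over that common horizon turns the pathwise bounds into
  \<open>delayed_recursion\<close>.\<close>

lemma expected_error_linear_rate:
  "\<exists>\<mu>bar>0. \<mu>bar * \<nu> \<le> 1 \<and> (\<forall>\<mu>. 0 < \<mu> \<and> \<mu> \<le> \<mu>bar \<longrightarrow>
     (\<exists>C\<ge>0. \<forall>i. expect_paths i (\<lambda>ns. ea (St \<mu> ns i)) \<le> C * (1 - \<mu> * \<nu> / 5) ^ i))"
proof -
  have N: "real CARD('n) \<ge> 1"
    by (simp add: Suc_leI)
  obtain \<mu>bar where \<mu>bar: "0 < \<mu>bar" "\<mu>bar \<le> 1" "\<mu>bar * \<nu> \<le> 1"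
    and rate: "\<forall>\<mu> a b d. 0 < \<mu> \<longrightarrow> \<mu> \<le> \<mu>bar \<longrightarrow> (\<forall>i. 0 \<le> a i) \<longrightarrow> (\<forall>i. 0 \<le> b i) \<longrightarrow> (\<forall>i. 0 \<le> d i) \<longrightarrow>
      delayed_recursion J (real CARD('n)) gain \<theta> \<nu> \<mu> a b d \<longrightarrow> (\<exists>C\<ge>0. \<forall>i. a i \<le> C * (1 - \<mu> * \<nu> / 5) ^ i)"
    using delayed_recursion_linear_rate[OF pos(4) N gain_ge(1) pos(5,6,3)] by blast
  have "\<exists>C\<ge>0. \<forall>i. expect_paths i (\<lambda>ns. ea (St \<mu> ns i)) \<le> C * (1 - \<mu> * \<nu> / 5) ^ i"
    if \<mu>: "0 < \<mu>" "\<mu> \<le> \<mu>bar" for \<mu>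
  proof -
    define X where "X f i = expect_paths i (\<lambda>ns. f (St \<mu> ns i))"
      for f :: "('m,'k,'n) pvrd_state \<Rightarrow> real" and i
    have \<mu>1: "\<mu> \<le> 1"
      using \<mu> \<mu>bar by simp
    have X: "expect_paths (i - J) (\<lambda>ns. f (St \<mu> ns j)) = X f j" if "j \<le> i" for i j f
      unfolding X_def using that by (intro expect_St) auto
    have X_Suc: "X f (Suc i) \<le> expect_paths (i - J) g"
      if "\<And>ns. (\<Sum>n\<in>UNIV. f (step \<mu> n (St \<mu> ns i) (St \<mu> ns (i - J + 1)))) / real CARD('n) \<le> g ns"
        "2 * J \<le> i" for f g i
      unfolding X_def using that by (subst expect_step) (auto intro: expect_paths_mono)
    have drift: "expect_paths (i - J) (\<lambda>ns. drift \<mu> ns i) = (\<Sum>j\<in>{i - J + 1..i}.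
        (X ea j + X eb j + X ed j) + (X ea (j - J + 1) + X eb (j - J + 1) + X ed (j - J + 1)))"
      if "2 * J \<le> i" for i
      unfolding drift_def expect_paths_sum expect_paths_add ey_def
    proof (intro sum.cong refl)
      fix j assume "j \<in> {i - J + 1..i}"
      then have "j \<le> i" "j - J + 1 \<le> i"
        using that pos(4) by auto
      then show "expect_paths (i - J) (\<lambda>ns. ea (St \<mu> ns j)) + expect_paths (i - J) (\<lambda>ns. eb (St \<mu> ns j))
          + expect_paths (i - J) (\<lambda>ns. ed (St \<mu> ns j))
          + (expect_paths (i - J) (\<lambda>ns. ea (St \<mu> ns (j - J + 1)))
          + expect_paths (i - J) (\<lambda>ns. eb (St \<mu> ns (j - J + 1)))
          + expect_paths (i - J) (\<lambda>ns. ed (St \<mu> ns (j - J + 1))))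
          = X ea j + X eb j + X ed j + (X ea (j - J + 1) + X eb (j - J + 1) + X ed (j - J + 1))"
        by (simp only: X)
    qed
    have s: "i - J + 1 \<le> i" if "2 * J \<le> i" for i
      using that pos by simp
    have "delayed_recursion J (real CARD('n)) gain \<theta> \<nu> \<mu> (X ea) (X eb) (X ed)"
      unfolding delayed_recursion_def Let_def
    proof (intro allI impI conjI)
      fix i assume i: "2 * J \<le> i"
      show "X ea (Suc i) \<le> (1 - \<mu> * \<nu>) * X ea i
          + \<mu> * gain * (X eb (i - J + 1) + X ed (i - J + 1))
          + \<mu>\<^sup>2 * gain * (\<Sum>j\<in>{i - J + 1..i}. (X ea j + X eb j + X ed j) +
            (X ea (j - J + 1) + X eb (j - J + 1) + X ed (j - J + 1)))"
        using X_Suc[OF path_ea[OF \<mu>(1) \<mu>1 i refl refl] i]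
        unfolding expect_paths_add expect_paths_cmult drift[OF i] X[OF order_refl] X[OF s[OF i]] .
      show "X eb (Suc i) \<le> (1 - 1 / real CARD('n)) * X eb i
          + \<theta> / real CARD('n) * X eb (i - J + 1) + gain * X ed (i - J + 1)"
        using X_Suc[OF path_eb[OF \<mu>(1) \<mu>1 i refl refl] i]
        unfolding expect_paths_add expect_paths_cmult X[OF order_refl] X[OF s[OF i]] .
      show "X ed (Suc i) \<le> (1 - 1 / (2 * real CARD('n))) * X ed i
          + \<mu>\<^sup>2 * gain * (\<Sum>j\<in>{i - J + 1..i}. (X ea j + X eb j + X ed j) +
            (X ea (j - J + 1) + X eb (j - J + 1) + X ed (j - J + 1)))"
        using X_Suc[OF path_ed[OF \<mu>(1) \<mu>1 i refl refl] i]
        unfolding expect_paths_add expect_paths_cmult drift[OF i] X[OF order_refl] X[OF s[OF i]] .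
    qed
    moreover have "0 \<le> X ea i" "0 \<le> X eb i" "0 \<le> X ed i" for i
      unfolding X_def by (intro expect_paths_nonneg err_nonneg)+
    ultimately have "\<exists>C\<ge>0. \<forall>i. X ea i \<le> C * (1 - \<mu> * \<nu> / 5) ^ i"
      using rate \<mu> by blast
    then show ?thesis
      by (simp add: X_def)
  qed
  with \<mu>bar show ?thesis
    by blast
qed

lemma blknorm2_le_ea: "blknorm2 blk k (pvrd_w A blk h \<gamma> dQ gr J \<mu> ns i k) wstar \<le> ea (St \<mu> ns i)"
proof -
  have "blknorm2 blk k (pvrd_w A blk h \<gamma> dQ gr J \<mu> ns i k) wstar =
      (\<Sum>j\<in>{j. blk j = k}. ((wv (St \<mu> ns i) - wstar) $ j)\<^sup>2)"
    by (simp add: blknorm2_def pvrd_w_def wv_def St_def)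
  also have "\<dots> \<le> (\<Sum>j\<in>UNIV. ((wv (St \<mu> ns i) - wstar) $ j)\<^sup>2)"
    by (rule sum_mono2) auto
  also have "\<dots> = ea (St \<mu> ns i)"
    unfolding ea_def power2_norm_eq_inner by (simp add: inner_vec_def power2_eq_square)
  finally show ?thesis .
qed

end

section \<open>From the hypotheses on risk and regularizer to the locale, and the final
  bound\<close>

text \<open>Both gradients represent the derivative at 0 of one and the same function. Applied to
  \<open>r k\<close>, it shows that \<open>gr k\<close> reads only block \<open>k\<close>.\<close>

lemma gradient_eq_of_translate_eq:
  fixes f :: "'a::real_inner \<Rightarrow> real"
  assumes f: "\<And>x. (f has_derivative (\<lambda>d. g x \<bullet> d)) (at x)"
    and eq: "\<And>t. f (x + t) = f (y + t)"
  shows "g x = g y"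
proof -
  have D: "((\<lambda>t. f (z + t)) has_derivative (\<lambda>d. g z \<bullet> d)) (at 0)" for z
  proof -
    have "(f has_derivative (\<lambda>d. g z \<bullet> d)) (at (z + 0))"
      using f[of z] by simp
    then show ?thesis
      by (rule has_derivative_compose[rotated]) (auto intro!: derivative_eq_intros)
  qed
  have "(\<lambda>t. f (x + t)) = (\<lambda>t. f (y + t))"
    using eq by blast
  then have "(\<lambda>d. g x \<bullet> d) = (\<lambda>d. g y \<bullet> d)"
    using D[of x] D[of y] by (metis has_derivative_unique)
  then show ?thesis
    by (metis vector_eq_rdot)
qed

theorem theorem1:
  fixes h :: "'n::finite \<Rightarrow> real^'m::finite"
    and \<gamma> :: "'n \<Rightarrow> real"
    and blk :: "'m \<Rightarrow> 'k::finite"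
    and Q dQ :: "real \<Rightarrow> real \<Rightarrow> real"
    and r :: "'k \<Rightarrow> real^'m \<Rightarrow> real"
    and gr :: "'k \<Rightarrow> real^'m \<Rightarrow> real^'m"
    and A :: "real^'k^'k"
    and E :: "'k \<Rightarrow> 'k \<Rightarrow> bool"
    and L \<delta> \<eta> \<nu> :: real
    and wstar :: "real^'m"
    and J :: nat
  assumes K2: "CARD('k) \<ge> 2"
    and Q_deriv: "\<And>z g. ((\<lambda>z. Q z g) has_real_derivative dQ z g) (at z)"
    and L_pos: "L > 0" and \<delta>_pos: "\<delta> > 0"
    and Q_lip: "\<And>n w1 w2. norm (dQ (h n \<bullet> w1) (\<gamma> n) *\<^sub>R h n - dQ (h n \<bullet> w2) (\<gamma> n) *\<^sub>R h n)
                   \<le> L * norm (w1 - w2)"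
    and dQ_lip: "\<And>n z1 z2. \<bar>dQ z1 (\<gamma> n) - dQ z2 (\<gamma> n)\<bar> \<le> \<delta> * \<bar>z1 - z2\<bar>"
    and r_block: "\<And>k x y. (\<forall>j. blk j = k \<longrightarrow> x$j = y$j) \<Longrightarrow> r k x = r k y"
    and r_deriv: "\<And>k x. (r k has_derivative (\<lambda>d. gr k x \<bullet> d)) (at x)"
    and r_convex: "convex_on UNIV (\<lambda>w. \<Sum>k\<in>UNIV. r k w)"
    and \<eta>_nonneg: "\<eta> \<ge> 0"
    and r_lip: "\<And>x y. norm ((\<Sum>k\<in>UNIV. gr k x) - (\<Sum>k\<in>UNIV. gr k y)) \<le> \<eta> * norm (x - y)"
    and \<nu>_pos: "\<nu> > 0"
    and R_strong: "\<And>w1 w2.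
          (((1 / real CARD('n)) *\<^sub>R (\<Sum>n\<in>UNIV. dQ (h n \<bullet> w1) (\<gamma> n) *\<^sub>R h n) + (\<Sum>k\<in>UNIV. gr k w1))
         - ((1 / real CARD('n)) *\<^sub>R (\<Sum>n\<in>UNIV. dQ (h n \<bullet> w2) (\<gamma> n) *\<^sub>R h n) + (\<Sum>k\<in>UNIV. gr k w2)))
          \<bullet> (w1 - w2) \<ge> \<nu> * (norm (w1 - w2))\<^sup>2"
    and wstar_min: "\<And>w. (1 / real CARD('n)) * (\<Sum>n\<in>UNIV. Q (h n \<bullet> wstar) (\<gamma> n)) + (\<Sum>k\<in>UNIV. r k wstar)
                     \<le> (1 / real CARD('n)) * (\<Sum>n\<in>UNIV. Q (h n \<bullet> w) (\<gamma> n)) + (\<Sum>k\<in>UNIV. r k w)"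
    and E_conn: "\<And>k l. E\<^sup>*\<^sup>* k l"
    and A_nonneg: "\<And>l k. A$l$k \<ge> 0"
    and A_support: "\<And>l k. A$l$k > 0 \<Longrightarrow> l = k \<or> E l k"
    and A_sym: "transpose A = A"
    and A_stoch: "A *v (\<chi> k. 1) = (\<chi> k. 1)"
    and A_diag: "\<exists>k. A$k$k > 0"
    and lam_range: "0 < second_largest_eig_mag A" "second_largest_eig_mag A < 1"
    and J_pos: "J \<ge> 1"
  shows "\<exists>\<mu>bar>0. \<forall>\<mu>. 0 < \<mu> \<and> \<mu> \<le> \<mu>bar \<longrightarrow>
           (\<exists>C. \<forall>k. \<forall>i>0.
              expect_paths i (\<lambda>ns. blknorm2 blk k (pvrd_w A blk h \<gamma> dQ gr J \<mu> ns i k) wstar)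
              \<le> (max (1 - (1 - second_largest_eig_mag A ^ J) / (2 * real CARD('n)))
                      (1 - \<mu> * \<nu> / 5)) ^ i * C)"
proof -
  obtain \<theta> where \<theta>: "0 < \<theta>" "\<theta> < 1"
    "\<And>x. (\<Sum>k\<in>UNIV. x$k) = 0 \<Longrightarrow> norm (A *v x) \<le> \<theta> * norm x"
    using symmetric_stochastic_contraction[OF A_sym A_stoch lam_range(2)] by blast
  let ?R = "\<lambda>w. (1 / real CARD('n)) * (\<Sum>n\<in>UNIV. Q (h n \<bullet> w) (\<gamma> n)) + (\<Sum>k\<in>UNIV. r k w)"
  let ?G = "(1 / real CARD('n)) *\<^sub>R (\<Sum>n\<in>UNIV. dQ (h n \<bullet> wstar) (\<gamma> n) *\<^sub>R h n) + (\<Sum>k\<in>UNIV. gr k wstar)"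
  have "((\<lambda>w. Q (h n \<bullet> w) (\<gamma> n)) has_derivative (\<lambda>d. dQ (h n \<bullet> wstar) (\<gamma> n) * (h n \<bullet> d))) (at wstar)" for n
    using Q_deriv[where z = "h n \<bullet> wstar" and g = "\<gamma> n"] unfolding has_field_derivative_def
    by (intro has_derivative_compose[of "\<lambda>w. h n \<bullet> w" "\<lambda>d. h n \<bullet> d" wstar UNIV "\<lambda>z. Q z (\<gamma> n)"]
        has_derivative_inner_right has_derivative_ident)
  then have "(?R has_derivative (\<lambda>d. (1 / real CARD('n)) * (\<Sum>n\<in>UNIV. dQ (h n \<bullet> wstar) (\<gamma> n) * (h n \<bullet> d))
      + (\<Sum>k\<in>UNIV. gr k wstar \<bullet> d))) (at wstar)"
    by (intro has_derivative_add has_derivative_mult_right has_derivative_sum r_deriv)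
  \<comment> \<open>First-order optimality of \<open>wstar\<close>, the source of the stationarity
    assumed by the locale.\<close>
  then have zero: "(\<lambda>d. (1 / real CARD('n)) * (\<Sum>n\<in>UNIV. dQ (h n \<bullet> wstar) (\<gamma> n) * (h n \<bullet> d))
      + (\<Sum>k\<in>UNIV. gr k wstar \<bullet> d)) = (\<lambda>d. 0)"
    by (rule differential_zero_maxmin[of wstar UNIV, rotated 2]) (use wstar_min in auto)
  have "?G \<bullet> d = 0" for d
    using fun_cong[OF zero, of d] by (simp add: inner_add_left inner_sum_left)
  then have stationary: "?G = 0"
    using inner_eq_zero_iff by blast
  have gr_local: "gr k x = gr k y" if "\<And>j. blk j = k \<Longrightarrow> x$j = y$j" for k x y
    by (rule gradient_eq_of_translate_eq[OF r_deriv]) (auto intro!: r_block simp: that)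
  \<comment> \<open>\<open>r k\<close> is constant along every axis outside its block, so that
    partial derivative vanishes.\<close>
  have gr_support: "gr k x $ j = 0" if "blk j \<noteq> k" for k x j
  proof -
    have line: "((\<lambda>t. r k (x + t *\<^sub>R axis j 1)) has_derivative (\<lambda>t. gr k x \<bullet> (t *\<^sub>R axis j 1))) (at 0)"
    proof -
      have "(r k has_derivative (\<lambda>d. gr k x \<bullet> d)) (at (x + 0 *\<^sub>R axis j 1))"
        using r_deriv[of k x] by simp
      then show ?thesis
        by (rule has_derivative_compose[rotated]) (auto intro!: derivative_eq_intros)
    qed
    have "r k (x + t *\<^sub>R axis j 1) = r k x" for t
      by (rule r_block) (use that in \<open>auto simp: axis_def\<close>)
    then have "((\<lambda>t. r k (x + t *\<^sub>R axis j 1)) has_derivative (\<lambda>t. 0)) (at 0)"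
      by simp
    with line have "(\<lambda>t. gr k x \<bullet> (t *\<^sub>R axis j 1)) = (\<lambda>t. 0)"
      by (rule has_derivative_unique)
    from fun_cong[OF this, of 1] show ?thesis
      by (simp add: inner_axis)
  qed
  interpret pvrd A blk h \<gamma> dQ gr J \<delta> \<eta> \<nu> \<theta> wstar
    by unfold_locales (fact dQ_lip gr_support gr_local r_lip R_strong stationary \<delta>_pos \<eta>_nonneg \<nu>_pos
        J_pos \<theta> A_sym A_stoch)+
  obtain \<mu>bar where \<mu>bar: "0 < \<mu>bar" "\<mu>bar * \<nu> \<le> 1" and rate: "\<And>\<mu>. 0 < \<mu> \<and> \<mu> \<le> \<mu>bar \<Longrightarrow>
     \<exists>C\<ge>0. \<forall>i. expect_paths i (\<lambda>ns. ea (St \<mu> ns i)) \<le> C * (1 - \<mu> * \<nu> / 5) ^ i"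
    using expected_error_linear_rate by blast
  show ?thesis
  proof (rule exI[of _ \<mu>bar], intro conjI allI impI)
    fix \<mu> assume \<mu>: "0 < \<mu> \<and> \<mu> \<le> \<mu>bar"
    then obtain C where C: "C \<ge> 0"
      "\<And>i. expect_paths i (\<lambda>ns. ea (St \<mu> ns i)) \<le> C * (1 - \<mu> * \<nu> / 5) ^ i"
      using rate by blast
    let ?\<rho> = "max (1 - (1 - second_largest_eig_mag A ^ J) / (2 * real CARD('n))) (1 - \<mu> * \<nu> / 5)"
    \<comment> \<open>Keeps \<open>1 - \<mu> * \<nu> / 5\<close> nonnegative, so that its powers
      compare with those of the maximum.\<close>
    have "\<mu> * \<nu> \<le> 1"
      using \<mu> \<mu>bar(2) mult_right_mono[of \<mu> \<mu>bar \<nu>] \<nu>_pos by linarith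
    have "expect_paths i (\<lambda>ns. blknorm2 blk k (pvrd_w A blk h \<gamma> dQ gr J \<mu> ns i k) wstar) \<le> ?\<rho> ^ i * C"
      for k i
    proof -
      have "expect_paths i (\<lambda>ns. blknorm2 blk k (pvrd_w A blk h \<gamma> dQ gr J \<mu> ns i k) wstar) \<le>
          expect_paths i (\<lambda>ns. ea (St \<mu> ns i))"
        by (intro expect_paths_mono blknorm2_le_ea)
      also have "\<dots> \<le> C * (1 - \<mu> * \<nu> / 5) ^ i"
        by (rule C)
      also have "\<dots> \<le> C * ?\<rho> ^ i"
        using C(1) \<open>\<mu> * \<nu> \<le> 1\<close> by (intro mult_left_mono power_mono) auto
      finally show ?thesis
        by (simp add: mult.commute)
    qed
    then show "\<exists>C. \<forall>k. \<forall>i>0.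
              expect_paths i (\<lambda>ns. blknorm2 blk k (pvrd_w A blk h \<gamma> dQ gr J \<mu> ns i k) wstar)
              \<le> ?\<rho> ^ i * C"
      by blast
  qed (use \<mu>bar in auto)
qed

end
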